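(* Let $2\le d<\infty$, let $L_1,\dots,L_d$ be integers and consider the periodic one-parameter group $\sigma$ of $*$-automorphisms of the Cuntz algebra $\mathcal{O}_d$ defined by $\sigma_t(s_j)=e^{itL_j}s_j$, $j=1,\dots,d$. Then the following conditions are equivalent. (i) The fixed-point algebra $\mathfrak{A}_L=\{x\in\mathcal{O}_d\mid\sigma_t(x)=x\ \forall t\}$ is an AF-algebra. (ii) All the $L_i$ have the same sign (in particular none are zero). (iii) There is a $\beta\in\mathbb{R}$ such that $\mathcal{O}_d$ admits a $(\sigma,\beta)$-KMS state. Furthermore, if these conditions are not fulfilled, $\mathfrak{A}_L$ contains an isometry which is not unitary.
   Context: $\mathcal{O}_d$ is the universal unital $C^*$-algebra generated by $s_1,\dots,s_d$ with $s_i^*s_j=\delta_{ij}1$, $\sum_i s_is_i^*=1$. A $(\sigma,\beta)$-KMS state is a state $\omega$ with $\omega(x\sigma_{i\beta}(y))=\omega(yx)$ for all $x,y$ in a norm-dense $\sigma$-invariant $*$-algebra of $\sigma$-analytic elements. An AF-algebra is a $C^*$-algebra that is the closure of the union of an increasing sequence of finite-dimensional $*$-subalgebras. *)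

theory Defs
  imports "HOL-Analysis.Analysis" "HOL-Library.Poly_Mapping"
begin

section \<open>Unital C*-algebras\<close>

text \<open>
  The distribution has only real normed algebras, so the complex scalar multiplication is a
  class parameter, tied to the real one by \<open>scaleR_scaleC\<close>. The axioms
  \<open>0 \<noteq> 1\<close> and \<open>norm 1 = 1\<close> inherited from \<open>real_normed_algebra_1\<close>
  exclude only the zero algebra. Homogeneity of the norm under complex scalars follows from the
  C*-identity.
\<close>

class unital_cstar_algebra = real_normed_algebra_1 + banach +
  fixes scaleC :: "complex \<Rightarrow> 'a \<Rightarrow> 'a"  (infixr \<open>*\<^sub>C\<close> 75)
    and adj :: "'a \<Rightarrow> 'a"  (\<open>_\<^sup>\<star>\<close> [1000] 1000)
  assumes scaleC_add_right: "c *\<^sub>C (x + y) = c *\<^sub>C x + c *\<^sub>C y"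
    and scaleC_add_left: "(b + c) *\<^sub>C x = b *\<^sub>C x + c *\<^sub>C x"
    and scaleC_scaleC: "b *\<^sub>C c *\<^sub>C x = (b * c) *\<^sub>C x"
    and scaleR_scaleC: "r *\<^sub>R x = complex_of_real r *\<^sub>C x"
    and mult_scaleC_left: "(c *\<^sub>C x) * y = c *\<^sub>C (x * y)"
    and mult_scaleC_right: "x * (c *\<^sub>C y) = c *\<^sub>C (x * y)"
    and adj_add: "(x + y)\<^sup>\<star> = x\<^sup>\<star> + y\<^sup>\<star>"
    and adj_scaleC: "(c *\<^sub>C x)\<^sup>\<star> = cnj c *\<^sub>C x\<^sup>\<star>"
    and adj_mult: "(x * y)\<^sup>\<star> = y\<^sup>\<star> * x\<^sup>\<star>"
    and adj_adj: "(x\<^sup>\<star>)\<^sup>\<star> = x"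
    and cstar_identity: "norm (x\<^sup>\<star> * x) = (norm x)\<^sup>2"

lemma scaleC_one [simp]: "1 *\<^sub>C x = (x :: 'a::unital_cstar_algebra)"
  using scaleR_scaleC[of 1 x] by simp

global_interpretation complex_vector:
  vector_space "scaleC :: complex \<Rightarrow> 'a \<Rightarrow> 'a::unital_cstar_algebra"
  by unfold_locales (simp_all add: scaleC_add_right scaleC_add_left scaleC_scaleC)

definition star_hom :: "('a::unital_cstar_algebra \<Rightarrow> 'b::unital_cstar_algebra) \<Rightarrow> bool" where
  "star_hom \<phi> \<longleftrightarrow>
     (\<forall>x y. \<phi> (x + y) = \<phi> x + \<phi> y) \<and> (\<forall>c x. \<phi> (c *\<^sub>C x) = c *\<^sub>C \<phi> x) \<and>
     (\<forall>x y. \<phi> (x * y) = \<phi> x * \<phi> y) \<and> (\<forall>x. \<phi> (x\<^sup>\<star>) = (\<phi> x)\<^sup>\<star>)"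

definition unital_star_hom :: "('a::unital_cstar_algebra \<Rightarrow> 'b::unital_cstar_algebra) \<Rightarrow> bool" where
  "unital_star_hom \<phi> \<longleftrightarrow> star_hom \<phi> \<and> \<phi> 1 = 1"

definition star_automorphism :: "('a::unital_cstar_algebra \<Rightarrow> 'a) \<Rightarrow> bool" where
  "star_automorphism \<phi> \<longleftrightarrow> star_hom \<phi> \<and> bij \<phi>"

text \<open>Not required to contain \<open>1\<close>, nor to be closed.\<close>

definition star_subalgebra :: "'a::unital_cstar_algebra set \<Rightarrow> bool" where
  "star_subalgebra B \<longleftrightarrow> complex_vector.subspace B \<and>
     (\<forall>x\<in>B. \<forall>y\<in>B. x * y \<in> B) \<and> (\<forall>x\<in>B. x\<^sup>\<star> \<in> B)"

definition finite_dimensional :: "'a::unital_cstar_algebra set \<Rightarrow> bool" where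
  "finite_dimensional B \<longleftrightarrow> (\<exists>T. finite T \<and> B \<subseteq> complex_vector.span T)"

definition AF_algebra :: "'a::unital_cstar_algebra set \<Rightarrow> bool" where
  "AF_algebra B \<longleftrightarrow>
     (\<exists>F :: nat \<Rightarrow> 'a set. (\<forall>n. star_subalgebra (F n) \<and> finite_dimensional (F n)) \<and>
        (\<forall>n. F n \<subseteq> F (Suc n)) \<and> B = closure (\<Union>n. F n))"

definition state :: "('a::unital_cstar_algebra \<Rightarrow> complex) \<Rightarrow> bool" where
  "state \<omega> \<longleftrightarrow>
     (\<forall>x y. \<omega> (x + y) = \<omega> x + \<omega> y) \<and> (\<forall>c x. \<omega> (c *\<^sub>C x) = c * \<omega> x) \<and>
     (\<forall>x. \<omega> (x\<^sup>\<star> * x) \<in> \<real>\<^sub>\<ge>\<^sub>0) \<and> \<omega> 1 = 1"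


section \<open>One-parameter groups, analytic elements and KMS states\<close>

definition one_parameter_group :: "(real \<Rightarrow> 'a::unital_cstar_algebra \<Rightarrow> 'a) \<Rightarrow> bool" where
  "one_parameter_group \<sigma> \<longleftrightarrow>
     (\<forall>t. star_automorphism (\<sigma> t)) \<and> \<sigma> 0 = id \<and> (\<forall>t u. \<sigma> (t + u) = \<sigma> t \<circ> \<sigma> u)"

definition fixed_point_algebra :: "(real \<Rightarrow> 'a::unital_cstar_algebra \<Rightarrow> 'a) \<Rightarrow> 'a set" where
  "fixed_point_algebra \<sigma> = {x. \<forall>t. \<sigma> t x = x}"

text \<open>
  \<open>y\<close> is \<open>\<sigma>\<close>-analytic iff \<open>\<exists>f. analytic_extension \<sigma> y f\<close>. Such an entire
  function \<open>f\<close> is determined by its values on the real axis, and \<open>\<sigma>\<^sub>z(y)\<close> denotes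
  \<open>f z\<close>. Differentiability is complex: the derivative is multiplication by a fixed
  element of the algebra.
\<close>

definition analytic_extension ::
    "(real \<Rightarrow> 'a::unital_cstar_algebra \<Rightarrow> 'a) \<Rightarrow> 'a \<Rightarrow> (complex \<Rightarrow> 'a) \<Rightarrow> bool" where
  "analytic_extension \<sigma> y f \<longleftrightarrow>
     (\<forall>z. \<exists>D. (f has_derivative (\<lambda>h. h *\<^sub>C D)) (at z)) \<and>
     (\<forall>t. f (complex_of_real t) = \<sigma> t y)"

text \<open>Below, \<open>f (\<i> * complex_of_real \<beta>)\<close> is \<open>\<sigma>\<^sub>i\<^sub>\<beta>(y)\<close>.\<close>

definition KMS_state ::
    "(real \<Rightarrow> 'a::unital_cstar_algebra \<Rightarrow> 'a) \<Rightarrow> real \<Rightarrow> ('a \<Rightarrow> complex) \<Rightarrow> bool" where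
  "KMS_state \<sigma> \<beta> \<omega> \<longleftrightarrow> state \<omega> \<and>
     (\<exists>D. star_subalgebra D \<and> closure D = UNIV \<and> (\<forall>t. \<forall>y\<in>D. \<sigma> t y \<in> D) \<and>
        (\<forall>y\<in>D. \<exists>f. analytic_extension \<sigma> y f \<and>
           (\<forall>x\<in>D. \<omega> (x * f (\<i> * complex_of_real \<beta>)) = \<omega> (y * x))))"


section \<open>The free unital *-algebra\<close>

text \<open>
  Words in the letters \<open>s\<^sub>j\<close> (\<open>Gen j\<close>) and \<open>s\<^sub>j\<^sup>\<star>\<close> (\<open>Adj j\<close>) form the
  free monoid. It is written additively because the convolution product on
  \<open>_ \<Rightarrow>\<^sub>0 _\<close> is defined for additive monoids; the free *-algebra is then its
  complex monoid algebra.
\<close>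

datatype 'd letter = Gen 'd | Adj 'd

datatype 'd word = Word (letters: "'d letter list")

instantiation word :: (type) monoid_add
begin

definition zero_word :: "'a word" where "0 = Word []"

definition plus_word :: "'a word \<Rightarrow> 'a word \<Rightarrow> 'a word" where
  "u + v = Word (letters u @ letters v)"

instance
  by standard (simp_all add: zero_word_def plus_word_def)

end

type_synonym 'd free_star_algebra = "'d word \<Rightarrow>\<^sub>0 complex"

fun letter_adj :: "'d letter \<Rightarrow> 'd letter" where
  "letter_adj (Gen j) = Adj j"
| "letter_adj (Adj j) = Gen j"

definition word_adj :: "'d word \<Rightarrow> 'd word" where
  "word_adj w = Word (rev (map letter_adj (letters w)))"

definition free_gen :: "'d \<Rightarrow> 'd free_star_algebra" where
  "free_gen j = Poly_Mapping.single (Word [Gen j]) 1"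

definition free_scale :: "complex \<Rightarrow> 'd free_star_algebra \<Rightarrow> 'd free_star_algebra" where
  "free_scale c f = Poly_Mapping.single 0 c * f"

definition free_adj :: "'d free_star_algebra \<Rightarrow> 'd free_star_algebra" where
  "free_adj f = (\<Sum>w\<in>Poly_Mapping.keys f.
     Poly_Mapping.single (word_adj w) (cnj (Poly_Mapping.lookup f w)))"

fun eval_letter :: "('d \<Rightarrow> 'a::unital_cstar_algebra) \<Rightarrow> 'd letter \<Rightarrow> 'a" where
  "eval_letter s (Gen j) = s j"
| "eval_letter s (Adj j) = (s j)\<^sup>\<star>"

definition eval_word :: "('d \<Rightarrow> 'a::unital_cstar_algebra) \<Rightarrow> 'd word \<Rightarrow> 'a" where
  "eval_word s w = prod_list (map (eval_letter s) (letters w))"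

definition eval_free :: "('d \<Rightarrow> 'a::unital_cstar_algebra) \<Rightarrow> 'd free_star_algebra \<Rightarrow> 'a" where
  "eval_free s f = (\<Sum>w\<in>Poly_Mapping.keys f. Poly_Mapping.lookup f w *\<^sub>C eval_word s w)"

definition cstar_seminorm :: "('d free_star_algebra \<Rightarrow> real) \<Rightarrow> bool" where
  "cstar_seminorm p \<longleftrightarrow>
     (\<forall>f. 0 \<le> p f) \<and> (\<forall>f g. p (f + g) \<le> p f + p g) \<and>
     (\<forall>c f. p (free_scale c f) = cmod c * p f) \<and>
     (\<forall>f g. p (f * g) \<le> p f * p g) \<and> (\<forall>f. p (free_adj f * f) = (p f)\<^sup>2)"


section \<open>The Cuntz algebra\<close>

definition cuntz_relations :: "('d::finite \<Rightarrow> 'a::unital_cstar_algebra) \<Rightarrow> bool" where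
  "cuntz_relations s \<longleftrightarrow>
     (\<forall>i j. (s i)\<^sup>\<star> * s j = (if i = j then 1 else 0)) \<and> (\<Sum>j\<in>UNIV. s j * (s j)\<^sup>\<star>) = 1"

definition seminorm_respects_cuntz_relations ::
    "('d::finite free_star_algebra \<Rightarrow> real) \<Rightarrow> bool" where
  "seminorm_respects_cuntz_relations p \<longleftrightarrow>
     (\<forall>i j. p (free_adj (free_gen i) * free_gen j - (if i = j then 1 else 0)) = 0) \<and>
     p ((\<Sum>j\<in>UNIV. free_gen j * free_adj (free_gen j)) - 1) = 0"

text \<open>
  The whole C*-algebra \<open>'a\<close>, with generators \<open>s\<close> indexed by \<open>'d\<close>, is the
  universal unital C*-algebra on the Cuntz relations: the completion of the free unital
  *-algebra in its greatest C*-seminorm respecting the relations. (The seminorm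
  \<open>\<lambda>f. norm (eval_free s f)\<close> is itself one of these.) This form avoids quantifying over all
  C*-algebras; the universal property for unital *-homomorphisms into arbitrary
  unital C*-algebras is derived from it in \<open>cuntz_algebra_universal\<close>.
\<close>

definition cuntz_algebra :: "('d::finite \<Rightarrow> 'a::unital_cstar_algebra) \<Rightarrow> bool" where
  "cuntz_algebra s \<longleftrightarrow>
     cuntz_relations s \<and> closure (range (eval_free s)) = UNIV \<and>
     (\<forall>p. cstar_seminorm p \<and> seminorm_respects_cuntz_relations p \<longrightarrow>
        (\<forall>f. p f \<le> norm (eval_free s f)))"

definition cuntz_flow ::
    "('d::finite \<Rightarrow> 'a::unital_cstar_algebra) \<Rightarrow> ('d \<Rightarrow> int) \<Rightarrow> (real \<Rightarrow> 'a \<Rightarrow> 'a) \<Rightarrow> bool" where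
  "cuntz_flow s L \<sigma> \<longleftrightarrow> one_parameter_group \<sigma> \<and>
     (\<forall>t j. \<sigma> t (s j) = cis (t * real_of_int (L j)) *\<^sub>C s j)"


section \<open>The universal property and existence of the flow\<close>

lemma norm_adj [simp]: "norm (x\<^sup>\<star>) = norm (x::'a::unital_cstar_algebra)"
proof -
  have *: "norm y \<le> norm (y\<^sup>\<star>)" for y :: 'a
  proof (cases "y = 0")
    case False
    have "norm y * norm y \<le> norm (y\<^sup>\<star>) * norm y"
      using norm_mult_ineq[of "y\<^sup>\<star>" y] by (simp add: cstar_identity power2_eq_square)
    with False show ?thesis by simp
  qed simp
  from *[of x] *[of "x\<^sup>\<star>"] show ?thesis by (simp add: adj_adj)
qed

lemma norm_scaleC [simp]: "norm (c *\<^sub>C x) = cmod c * norm (x::'a::unital_cstar_algebra)"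
proof -
  have "(norm (c *\<^sub>C x))\<^sup>2 = norm ((cnj c * c) *\<^sub>C (x\<^sup>\<star> * x))"
    by (simp only: cstar_identity[symmetric] adj_scaleC mult_scaleC_left mult_scaleC_right
        scaleC_scaleC mult.commute)
  also have "cnj c * c = complex_of_real ((cmod c)\<^sup>2)"
    by (metis complex_norm_square mult.commute)
  also have "norm (complex_of_real ((cmod c)\<^sup>2) *\<^sub>C (x\<^sup>\<star> * x)) = (cmod c * norm x)\<^sup>2"
    by (simp only: scaleR_scaleC[symmetric] norm_scaleR cstar_identity)
      (simp add: power_mult_distrib)
  finally show ?thesis by simp
qed

lemma adj_zero [simp]: "(0::'a::unital_cstar_algebra)\<^sup>\<star> = 0"
  using adj_add[of "0::'a" 0] by simp

lemma adj_one [simp]: "(1::'a::unital_cstar_algebra)\<^sup>\<star> = 1"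
  by (metis adj_adj adj_mult mult.left_neutral mult.right_neutral)

lemma adj_minus: "(- x)\<^sup>\<star> = - ((x::'a::unital_cstar_algebra)\<^sup>\<star>)"
  by (metis adj_add adj_zero add.right_inverse minus_unique)

lemma adj_diff: "(x - y)\<^sup>\<star> = x\<^sup>\<star> - (y::'a::unital_cstar_algebra)\<^sup>\<star>"
  using adj_add[of x "- y"] by (simp add: adj_minus)

lemma free_star_algebra_induct [case_names zero add]:
  fixes f :: "'d free_star_algebra"
  assumes "P 0" and "\<And>f w c. P f \<Longrightarrow> P (Poly_Mapping.single w c + f)"
  shows "P f"
proof -
  have *: "P (\<Sum>w\<in>K. Poly_Mapping.single w (Poly_Mapping.lookup f w))" if "finite K" for K
    using that by induction (simp_all add: assms)
  have "f = (\<Sum>w\<in>Poly_Mapping.keys f. Poly_Mapping.single w (Poly_Mapping.lookup f w))"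
    by (rule poly_mapping_eqI)
      (simp add: lookup_sum lookup_single when_def in_keys_iff)
  with *[of "Poly_Mapping.keys f"] show ?thesis by simp
qed

lemma eval_free_superset:
  assumes "finite K" "Poly_Mapping.keys f \<subseteq> K"
  shows "eval_free s f = (\<Sum>w\<in>K. Poly_Mapping.lookup f w *\<^sub>C eval_word s w)"
  unfolding eval_free_def using assms
  by (intro sum.mono_neutral_left) (auto simp: in_keys_iff)

lemma eval_free_zero [simp]: "eval_free s 0 = 0"
  by (simp add: eval_free_def)

lemma eval_free_add: "eval_free s (f + g) = eval_free s f + eval_free s g"
proof -
  let ?K = "Poly_Mapping.keys f \<union> Poly_Mapping.keys g"
  have "Poly_Mapping.keys (f + g) \<subseteq> ?K" by (rule Poly_Mapping.keys_add)
  then show ?thesis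
    by (simp add: eval_free_superset[of ?K] lookup_add scaleC_add_left sum.distrib)
qed

lemma eval_free_single [simp]: "eval_free s (Poly_Mapping.single w c) = c *\<^sub>C eval_word s w"
  by (simp add: eval_free_superset[of "{w}"])

lemma eval_free_minus: "eval_free s (- f) = - eval_free s f"
  by (metis eval_free_add eval_free_zero add.right_inverse minus_unique)

lemma eval_free_diff: "eval_free s (f - g) = eval_free s f - eval_free s g"
  using eval_free_add[of s f "- g"] by (simp add: eval_free_minus)

lemma eval_free_sum: "eval_free s (\<Sum>i\<in>I. f i) = (\<Sum>i\<in>I. eval_free s (f i))"
  by (induction I rule: infinite_finite_induct) (simp_all add: eval_free_add)

lemma eval_word_zero [simp]: "eval_word s 0 = 1"
  by (simp add: eval_word_def zero_word_def)

lemma eval_word_add: "eval_word s (u + v) = eval_word s u * eval_word s v"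
  by (simp add: eval_word_def plus_word_def)

lemma eval_word_adj: "eval_word s (word_adj w) = (eval_word s w)\<^sup>\<star>"
proof -
  have 1: "eval_letter s (letter_adj l) = (eval_letter s l)\<^sup>\<star>" for l
    by (cases l) (simp_all add: adj_adj)
  have "prod_list (map (eval_letter s) (rev (map letter_adj ls))) =
      (prod_list (map (eval_letter s) ls))\<^sup>\<star>" for ls
    by (induction ls) (simp_all add: 1 adj_mult)
  then show ?thesis by (simp add: eval_word_def word_adj_def)
qed

lemma eval_free_one [simp]: "eval_free s 1 = 1"
  by (simp flip: single_one)

lemma eval_free_mult: "eval_free s (f * g) = eval_free s f * eval_free s g"
proof -
  have *: "eval_free s (Poly_Mapping.single w c * g) = (c *\<^sub>C eval_word s w) * eval_free s g" for w c
    by (induction g rule: free_star_algebra_induct)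
      (simp_all add: distrib_left eval_free_add mult_single eval_word_add
        mult_scaleC_left mult_scaleC_right scaleC_scaleC mult.commute)
  show ?thesis
    by (induction f rule: free_star_algebra_induct)
      (simp_all add: distrib_right eval_free_add *)
qed

lemma eval_free_scale: "eval_free s (free_scale c f) = c *\<^sub>C eval_free s f"
  by (simp add: free_scale_def eval_free_mult mult_scaleC_left)

lemma adj_sum: "(\<Sum>i\<in>I. f i)\<^sup>\<star> = (\<Sum>i\<in>I. (f i :: 'a::unital_cstar_algebra)\<^sup>\<star>)"
  by (induction I rule: infinite_finite_induct) (simp_all add: adj_add)

lemma eval_free_adj: "eval_free s (free_adj f) = (eval_free s f)\<^sup>\<star>"
  unfolding free_adj_def eval_free_sum eval_free_single eval_word_adj
  by (simp add: eval_free_def adj_sum adj_scaleC)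

lemma eval_free_gen [simp]: "eval_free s (free_gen j) = s j"
  by (simp add: free_gen_def eval_word_def)

lemma cstar_seminorm_eval: "cstar_seminorm (\<lambda>f. norm (eval_free s f))"
  unfolding cstar_seminorm_def
  by (auto simp: eval_free_add eval_free_scale eval_free_mult eval_free_adj cstar_identity
      norm_triangle_ineq norm_mult_ineq)

lemma seminorm_respects_cuntz_relations_eval:
  "seminorm_respects_cuntz_relations (\<lambda>f. norm (eval_free s f)) \<longleftrightarrow> cuntz_relations s"
  unfolding seminorm_respects_cuntz_relations_def cuntz_relations_def
  by (auto simp: eval_free_diff eval_free_sum eval_free_mult eval_free_adj split: if_splits)

lemma star_hom_eval_free:
  assumes "unital_star_hom \<phi>"
  shows "\<phi> (eval_free s f) = eval_free (\<lambda>j. \<phi> (s j)) f"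
proof -
  have h: "\<phi> (x + y) = \<phi> x + \<phi> y" "\<phi> (c *\<^sub>C x) = c *\<^sub>C \<phi> x"
    "\<phi> (x * y) = \<phi> x * \<phi> y" "\<phi> (x\<^sup>\<star>) = (\<phi> x)\<^sup>\<star>" "\<phi> 1 = 1" for x y c
    using assms by (auto simp: unital_star_hom_def star_hom_def)
  have 0: "\<phi> 0 = 0" using h(1)[of 0 0] by simp
  have l: "\<phi> (eval_letter s l) = eval_letter (\<lambda>j. \<phi> (s j)) l" for l
    by (cases l) (simp_all add: h)
  have "\<phi> (prod_list (map (eval_letter s) ls)) =
      prod_list (map (eval_letter (\<lambda>j. \<phi> (s j))) ls)" for ls
    by (induction ls) (simp_all add: h l)
  then have w: "\<phi> (eval_word s w) = eval_word (\<lambda>j. \<phi> (s j)) w" for w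
    by (simp add: eval_word_def)
  show ?thesis
    by (induction f rule: free_star_algebra_induct) (simp_all add: eval_free_add h 0 w)
qed

lemma scaleC_continuous [continuous_intros]:
  fixes f :: "'c::topological_space \<Rightarrow> 'a::unital_cstar_algebra"
  assumes "continuous_on S f"
  shows "continuous_on S (\<lambda>x. c *\<^sub>C f x)"
proof -
  have "bounded_linear (\<lambda>x::'a. c *\<^sub>C x)"
    by (rule bounded_linear_intro[where K = "cmod c"])
      (simp_all add: scaleC_add_right scaleR_scaleC scaleC_scaleC mult.commute)
  then show ?thesis using assms by (rule bounded_linear.continuous_on)
qed

lemma adj_continuous [continuous_intros]:
  fixes f :: "'c::topological_space \<Rightarrow> 'a::unital_cstar_algebra"
  assumes "continuous_on S f"
  shows "continuous_on S (\<lambda>x. (f x)\<^sup>\<star>)"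
proof -
  have "bounded_linear (\<lambda>x::'a. x\<^sup>\<star>)"
    by (rule bounded_linear_intro[where K = 1])
      (simp_all add: adj_add scaleR_scaleC adj_scaleC)
  then show ?thesis using assms by (rule bounded_linear.continuous_on)
qed

lemma continuous_eq_on_dense:
  fixes f g :: "'a::topological_space \<Rightarrow> 'b::t2_space"
  assumes "closure X = UNIV" "continuous_on UNIV f" "continuous_on UNIV g"
    and "\<And>x. x \<in> X \<Longrightarrow> f x = g x"
  shows "f x = g x"
proof -
  have "closed {x. f x = g x}" using assms(2,3) by (rule closed_Collect_eq)
  moreover have "X \<subseteq> {x. f x = g x}" using assms(4) by auto
  ultimately have "closure X \<subseteq> {x. f x = g x}" by (rule closure_minimal[rotated])
  then show ?thesis using assms(1) by auto
qed

lemma cuntz_algebra_hom_ex: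
  fixes s :: "'d::finite \<Rightarrow> 'a::unital_cstar_algebra"
    and t :: "'d \<Rightarrow> 'b::unital_cstar_algebra"
  assumes s: "cuntz_algebra s" and t: "cuntz_relations t"
  shows "\<exists>\<phi>. unital_star_hom \<phi> \<and> continuous_on UNIV \<phi> \<and> (\<forall>j. \<phi> (s j) = t j)"
proof -
  let ?X = "range (eval_free s)"
  have dense: "closure ?X = UNIV" using s by (simp add: cuntz_algebra_def)
  have le: "norm (eval_free t f) \<le> norm (eval_free s f)" for f
    using s t cstar_seminorm_eval[of t] seminorm_respects_cuntz_relations_eval[of t]
    unfolding cuntz_algebra_def
    by (elim conjE allE[where x = "\<lambda>f. norm (eval_free t f)"]) auto
  define \<psi> where "\<psi> x = eval_free t (SOME f. eval_free s f = x)" for x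
  have \<psi>: "\<psi> (eval_free s f) = eval_free t f" for f
  proof -
    let ?g = "SOME g. eval_free s g = eval_free s f"
    have "eval_free s ?g = eval_free s f" by (rule someI) simp
    then have "norm (eval_free t (?g - f)) \<le> 0"
      using le[of "?g - f"] by (simp add: eval_free_diff)
    then show ?thesis by (simp add: eval_free_diff \<psi>_def)
  qed
  have "uniformly_continuous_on ?X \<psi>"
    unfolding uniformly_continuous_on_def dist_norm
  proof (intro allI impI)
    fix e :: real assume "e > 0"
    moreover have "norm (\<psi> x' - \<psi> x) \<le> norm (x' - x)" if x: "x \<in> ?X" "x' \<in> ?X" for x x'
    proof -
      obtain f f' where "x = eval_free s f" "x' = eval_free s f'" using x by blast
      then show ?thesis using le[of "f' - f"] by (simp add: \<psi> eval_free_diff)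
    qed
    ultimately show "\<exists>d>0. \<forall>x\<in>?X. \<forall>x'\<in>?X. norm (x' - x) < d \<longrightarrow> norm (\<psi> x' - \<psi> x) < e"
      by (intro exI[of _ e]) (meson le_less_trans)
  qed
  then obtain \<phi> where uc: "uniformly_continuous_on (closure ?X) \<phi>"
    and eq: "\<And>x. x \<in> ?X \<Longrightarrow> \<psi> x = \<phi> x"
    by (rule uniformly_continuous_on_extension_on_closure) blast
  have cont: "continuous_on UNIV \<phi>"
    using uniformly_continuous_imp_continuous[OF uc] dense by simp
  note cont' = continuous_on_compose2[OF cont]
  have \<phi>: "\<phi> (eval_free s f) = eval_free t f" for f
    using eq[of "eval_free s f"] \<psi> by simp
  have dense2: "closure (?X \<times> ?X) = UNIV"
    by (simp add: closure_Times dense)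
  have add: "\<phi> (fst z + snd z) = \<phi> (fst z) + \<phi> (snd z)" for z
    by (rule continuous_eq_on_dense[OF dense2])
      (auto intro!: continuous_intros cont' simp: \<phi> simp flip: eval_free_add)
  have mult: "\<phi> (fst z * snd z) = \<phi> (fst z) * \<phi> (snd z)" for z
    by (rule continuous_eq_on_dense[OF dense2])
      (auto intro!: continuous_intros cont' simp: \<phi> simp flip: eval_free_mult)
  have scale: "\<phi> (c *\<^sub>C x) = c *\<^sub>C \<phi> x" for c x
    by (rule continuous_eq_on_dense[OF dense])
      (auto intro!: continuous_intros cont' cont simp: \<phi> simp flip: eval_free_scale)
  have adj: "\<phi> (x\<^sup>\<star>) = (\<phi> x)\<^sup>\<star>" for x
    by (rule continuous_eq_on_dense[OF dense])
      (auto intro!: continuous_intros cont' cont simp: \<phi> simp flip: eval_free_adj)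
  have "\<phi> 1 = 1" using \<phi>[of 1] by simp
  with add[of "(_, _)"] mult[of "(_, _)"] scale adj have "unital_star_hom \<phi>"
    by (simp add: unital_star_hom_def star_hom_def)
  moreover have "\<phi> (s j) = t j" for j using \<phi>[of "free_gen j"] by simp
  moreover note cont
  ultimately show ?thesis by blast
qed


lemma cuntz_algebra_hom_unique:
  fixes s :: "'d::finite \<Rightarrow> 'a::unital_cstar_algebra" and \<phi> \<psi> :: "'a \<Rightarrow> 'b::unital_cstar_algebra"
  assumes s: "cuntz_algebra s"
    and "unital_star_hom \<phi>" "continuous_on UNIV \<phi>" "unital_star_hom \<psi>" "continuous_on UNIV \<psi>"
    and eq: "\<And>j. \<phi> (s j) = \<psi> (s j)"
  shows "\<phi> = \<psi>"
proof
  fix x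
  have dense: "closure (range (eval_free s)) = UNIV" using s by (simp add: cuntz_algebra_def)
  show "\<phi> x = \<psi> x"
    by (rule continuous_eq_on_dense[OF dense]) (use assms in \<open>auto simp: star_hom_eval_free\<close>)
qed

text \<open>The continuity requirement is redundant, since *-homomorphisms of C*-algebras are contractive.\<close>

theorem cuntz_algebra_universal:
  fixes s :: "'d::finite \<Rightarrow> 'a::unital_cstar_algebra"
    and t :: "'d \<Rightarrow> 'b::unital_cstar_algebra"
  assumes "cuntz_algebra s" and "cuntz_relations t"
  shows "\<exists>!\<phi>. unital_star_hom \<phi> \<and> continuous_on UNIV \<phi> \<and> (\<forall>j. \<phi> (s j) = t j)"
  using cuntz_algebra_hom_ex[OF assms] cuntz_algebra_hom_unique[OF assms(1)]
  by (metis (no_types, lifting))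

theorem cuntz_flow_exists:
  fixes s :: "'d::finite \<Rightarrow> 'a::unital_cstar_algebra"
  assumes s: "cuntz_algebra s"
  shows "\<exists>\<sigma>. cuntz_flow s L \<sigma>"
proof -
  define z where "z t j = cis (t * real_of_int (L j))" for t j
  have z: "z (t + u) j = z t j * z u j" "z 0 j = 1" "cnj (z t j) * z t j = 1" for t u j
    by (simp_all add: z_def cis_mult distrib_right cis_cnj)
  have "cuntz_relations (\<lambda>j. z t j *\<^sub>C s j)" for t
    using s z(3)[of t]
    by (auto simp: cuntz_algebra_def cuntz_relations_def adj_scaleC mult_scaleC_left
        mult_scaleC_right scaleC_scaleC mult.commute)
  from cuntz_algebra_hom_ex[OF s this] obtain \<sigma> where
    hom: "\<And>t. unital_star_hom (\<sigma> t)" and cont: "\<And>t. continuous_on UNIV (\<sigma> t)"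
    and gen: "\<And>t j. \<sigma> t (s j) = z t j *\<^sub>C s j"
    by metis
  have scale: "\<sigma> t (c *\<^sub>C x) = c *\<^sub>C \<sigma> t x" for t c x
    using hom by (simp add: unital_star_hom_def star_hom_def)
  have zero: "\<sigma> 0 = id"
    by (rule cuntz_algebra_hom_unique[OF s hom cont])
      (auto simp: unital_star_hom_def star_hom_def gen z)
  have add: "\<sigma> (t + u) = \<sigma> t \<circ> \<sigma> u" for t u
  proof (rule cuntz_algebra_hom_unique[OF s hom cont])
    show "unital_star_hom (\<sigma> t \<circ> \<sigma> u)"
      using hom[of t] hom[of u] by (simp add: unital_star_hom_def star_hom_def)
    show "continuous_on UNIV (\<sigma> t \<circ> \<sigma> u)"
      using cont[of t] cont[of u] continuous_on_subset by (intro continuous_on_compose) blast+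
  qed (simp add: gen z scale scaleC_scaleC mult.commute)
  have "bij (\<sigma> t)" for t
    using add[of t "- t"] add[of "- t" t] by (intro o_bij[of "\<sigma> (- t)"]) (simp_all add: zero)
  with hom zero add show ?thesis
    by (intro exI[of _ \<sigma>])
      (simp add: cuntz_flow_def one_parameter_group_def star_automorphism_def
        unital_star_hom_def gen flip: z_def)
qed

end

theory Submission
  imports Defs "HOL-Complex_Analysis.Complex_Analysis"
begin

text \<open>
  If \<open>L\<close> takes a zero value or values of both signs, some nonempty word in the generators has
  weight zero; it is an invariant nonunitary isometry, which no AF-algebra contains. If all
  \<open>L j\<close> are positive, the monomials \<open>s\<^sub>\<mu> s\<^sub>\<nu>\<^sup>\<star>\<close> with \<open>L(\<mu>) = L(\<nu>) \<le> n\<close> span a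
  finite-dimensional *-algebra, since a product of two of them is another one or zero; averaging
  over the flow shows that the union over \<open>n\<close> is dense in the fixed-point algebra.

  A KMS state satisfies \<open>\<omega>(s\<^sub>j s\<^sub>j\<^sup>\<star>) = exp (-\<beta> L j)\<close>. These numbers are positive and sum to 1, so
  each is less than 1 and \<open>\<beta> L j > 0\<close> for every \<open>j\<close>. Conversely, for weights \<open>p j = exp (-\<beta> L j)\<close>
  of sum 1, the iterates of the unital completely positive map
  \<open>x \<mapsto> \<Sum>j. p j s\<^sub>j\<^sup>\<star> x s\<^sub>j\<close> converge to \<open>\<omega>(x) 1\<close>, and the invariance of \<open>\<omega>\<close> under this map is
  the KMS condition on the generators.
\<close>

text \<open>The definitions are algebraic: \<open>one_parameter_group\<close> contains no
  continuity, \<open>state\<close> no boundedness, and the KMS condition concerns some dense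
  \<open>D\<close> that may miss the generators. The arguments approximate, so norm control is
  earned first: unital *-homomorphisms are contractive, and a state is bounded by twice the norm.
  Contractivity makes the fixed-point algebra closed and lets averages over the flow act on
  approximants. Boundedness of states lets the KMS identity pass from \<open>D\<close> to
  \<open>s j\<close>: pairing approximants of \<open>s j\<close> and its adjoint yields an entire
  function of period \<open>2 * pi\<close>, whose Fourier coefficient at \<open>L j\<close>
  tolerates small errors and can be computed both on the real line and on the line of imaginary part
  \<beta>.\<close>

lemma bounded_linear_adj: "bounded_linear (\<lambda>x::'a::unital_cstar_algebra. x\<^sup>\<star>)"
  by (rule bounded_linear_intro[where K = 1])
    (simp_all add: adj_add scaleR_scaleC adj_scaleC)

lemma adj_power: "(x ^ n)\<^sup>\<star> = (x\<^sup>\<star>) ^ n" for x :: "'a::unital_cstar_algebra"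
  by (induction n) (simp_all add: adj_mult power_commutes)

lemma adj_scaleR: "(r *\<^sub>R x)\<^sup>\<star> = r *\<^sub>R (x\<^sup>\<star>)" for x :: "'a::unital_cstar_algebra"
  by (simp add: scaleR_scaleC adj_scaleC)

lemma neumann_inverse:
  fixes x :: "'a::{real_normed_algebra_1,banach}"
  assumes "norm x < 1"
  obtains y where "(1 - x) * y = 1" "y * (1 - x) = 1"
proof
  define y where "y = suminf (\<lambda>n. x ^ n)"
  have S: "summable (\<lambda>n. x ^ n)" using assms by (rule complete_algebra_summable_geometric)
  have "y = 1 + suminf (\<lambda>n. x ^ Suc n)" using suminf_split_head[OF S] by (simp add: y_def)
  then have "y = 1 + x * y" "y = 1 + y * x"
    using suminf_mult[OF S, of x] suminf_mult2[OF S, of x] by (simp_all add: y_def power_commutes)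
  then show "(1 - x) * y = 1" "y * (1 - x) = 1"
    by (simp_all add: left_diff_distrib right_diff_distrib diff_eq_eq)
qed

subsection \<open>Automatic contractivity\<close>

text \<open>Says that the spectrum of \<open>b\<close> lies in the open unit disc. The variable is
  the inverse of the spectral parameter, so the value at 0 is 1 and rescaling towards 0 moves the
  resolvent towards 1.\<close>

definition disc_resolvent :: "'a::unital_cstar_algebra \<Rightarrow> (complex \<Rightarrow> 'a) \<Rightarrow> bool" where
  "disc_resolvent b R \<longleftrightarrow>
     (\<forall>z. cmod z \<le> 1 \<longrightarrow> (1 - z *\<^sub>C b) * R z = 1 \<and> R z * (1 - z *\<^sub>C b) = 1)"

lemma disc_resolvent_unique:
  assumes "disc_resolvent b R" "cmod z \<le> 1" "(1 - z *\<^sub>C b) * y = 1"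
  shows "y = R z"
proof -
  have "R z * ((1 - z *\<^sub>C b) * y) = y"
    using assms(1,2) by (simp add: disc_resolvent_def flip: mult.assoc)
  then show ?thesis using assms(3) by simp
qed

lemma disc_resolvent_identity:
  assumes "disc_resolvent b R" "cmod z \<le> 1" "cmod w \<le> 1"
  shows "R z - R w = (z - w) *\<^sub>C (R z * b * R w)"
proof -
  have "R z * ((1 - w *\<^sub>C b) - (1 - z *\<^sub>C b)) * R w
      = R z * ((1 - w *\<^sub>C b) * R w) - (R z * (1 - z *\<^sub>C b)) * R w"
    by (simp only: right_diff_distrib left_diff_distrib mult.assoc)
  also have "\<dots> = R z - R w"
    using assms by (simp add: disc_resolvent_def)
  finally have "R z - R w = R z * ((1 - w *\<^sub>C b) - (1 - z *\<^sub>C b)) * R w" ..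
  also have "(1 - w *\<^sub>C b) - (1 - z *\<^sub>C b) = (z - w) *\<^sub>C b"
    using scaleC_add_left[of "z - w" w b] by simp
  finally show ?thesis by (simp add: mult_scaleC_left mult_scaleC_right)
qed

text \<open>The resolvent identity bounds the difference by a multiple of \<open>norm (R z)\<close>,
  which is not under control beforehand. For \<open>z\<close> close to \<open>w\<close> that
  multiple is at most 1/2, which forces \<open>norm (R z)\<close> below twice
  \<open>norm (R w)\<close>; inserting this into the same estimate gives continuity.\<close>

lemma disc_resolvent_continuous:
  assumes R: "disc_resolvent b R"
  shows "continuous_on (cball 0 1) R"
proof (rule continuous_on_iff[THEN iffD2], intro ballI allI impI)
  fix w :: complex and e :: real assume w: "w \<in> cball 0 1" and e: "e > 0"
  define K where "K = norm b * norm (R w) + 1"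
  have K: "K > 0" by (simp add: K_def add_nonneg_pos)
  define M where "M = 2 * norm (R w) * K + 1"
  have M: "M > 0" using K by (simp add: M_def add_nonneg_pos)
  define d where "d = min (1 / (2 * K)) (e / M)"
  have "dist (R z) (R w) < e" if z: "z \<in> cball 0 1" "dist z w < d" for z
  proof -
    have dz: "cmod (z - w) * K \<le> 1 / 2" "cmod (z - w) * M < e"
      using z K M by (auto simp: d_def dist_norm field_simps)
    have "norm (R z - R w) \<le> cmod (z - w) * (norm (R z) * norm b * norm (R w))"
      using disc_resolvent_identity[OF R, of z w] z w
      by (auto intro!: mult_left_mono order_trans[OF norm_mult_ineq] mult_right_mono norm_mult_ineq)
    also have "\<dots> = cmod (z - w) * (norm b * norm (R w)) * norm (R z)" by (simp add: ac_simps)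
    also have "\<dots> \<le> cmod (z - w) * K * norm (R z)"
      by (intro mult_left_mono mult_right_mono) (auto simp: K_def)
    finally have 1: "norm (R z - R w) \<le> cmod (z - w) * K * norm (R z)" .
    also have "\<dots> \<le> 1 / 2 * norm (R z)" using dz by (intro mult_right_mono) auto
    finally have "norm (R z) \<le> 2 * norm (R w)"
      using norm_triangle_ineq2[of "R z" "R w"] by linarith
    then have "cmod (z - w) * K * norm (R z) \<le> cmod (z - w) * K * (2 * norm (R w))"
      using K by (intro mult_left_mono) auto
    with 1 have "norm (R z - R w) \<le> cmod (z - w) * (2 * norm (R w) * K)"
      by (simp add: ac_simps)
    also have "\<dots> \<le> cmod (z - w) * M" by (intro mult_left_mono) (auto simp: M_def)
    finally show ?thesis using dz by (simp add: dist_norm)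
  qed
  moreover have "d > 0" using K M e by (simp add: d_def)
  ultimately show "\<exists>d>0. \<forall>z\<in>cball 0 1. dist z w < d \<longrightarrow> dist (R z) (R w) < e" by blast
qed

text \<open>Partial fractions: 1/(1 - x^2) is the mean of 1/(1 - x) and 1/(1 + x), with x = w b. The
  mean is even in \<open>w\<close>, so the choice of square root is immaterial; formally this is
  uniqueness of inverses.\<close>

lemma disc_resolvent_square:
  assumes R: "disc_resolvent b R"
  obtains R' where "disc_resolvent (b\<^sup>2) R'"
    and "\<And>w. cmod w \<le> 1 \<Longrightarrow> R' (w\<^sup>2) = (1/2) *\<^sub>R (R w + R (- w))"
proof -
  define h where "h w = (1/2) *\<^sub>R (R w + R (- w))" for w
  have sq: "(1 - w *\<^sub>C b) * (1 + w *\<^sub>C b) = 1 - w\<^sup>2 *\<^sub>C b\<^sup>2"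
           "(1 + w *\<^sub>C b) * (1 - w *\<^sub>C b) = 1 - w\<^sup>2 *\<^sub>C b\<^sup>2" for w
    by (simp_all add: algebra_simps mult_scaleC_left mult_scaleC_right scaleC_scaleC power2_eq_square)
  have inv: "(1 - w\<^sup>2 *\<^sub>C b\<^sup>2) * h w = 1 \<and> h w * (1 - w\<^sup>2 *\<^sub>C b\<^sup>2) = 1" if "cmod w \<le> 1" for w
  proof -
    have neg: "1 - (- w) *\<^sub>C b = 1 + w *\<^sub>C b" by simp
    have r: "(1 - w *\<^sub>C b) * R w = 1" "R w * (1 - w *\<^sub>C b) = 1"
      using R that by (auto simp: disc_resolvent_def)
    have r': "(1 + w *\<^sub>C b) * R (-w) = 1" "R (-w) * (1 + w *\<^sub>C b) = 1"
      using R[unfolded disc_resolvent_def, rule_format, of "- w"] that unfolding neg by auto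
    have "(1 - w\<^sup>2 *\<^sub>C b\<^sup>2) * R w = 1 + w *\<^sub>C b"
      unfolding sq(2)[symmetric] mult.assoc r by simp
    moreover have "(1 - w\<^sup>2 *\<^sub>C b\<^sup>2) * R (- w) = 1 - w *\<^sub>C b"
      unfolding sq(1)[symmetric] mult.assoc r' by simp
    moreover have "R w * (1 - w\<^sup>2 *\<^sub>C b\<^sup>2) = 1 + w *\<^sub>C b"
      unfolding sq(1)[symmetric] mult.assoc[symmetric] r by simp
    moreover have "R (- w) * (1 - w\<^sup>2 *\<^sub>C b\<^sup>2) = 1 - w *\<^sub>C b"
      unfolding sq(2)[symmetric] mult.assoc[symmetric] r' by simp
    ultimately show ?thesis
      by (simp add: h_def distrib_left distrib_right flip: scaleR_2)
  qed
  have R': "disc_resolvent (b\<^sup>2) (\<lambda>z. h (csqrt z))"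
    using inv[of "csqrt _"] unfolding disc_resolvent_def by (simp add: norm_csqrt)
  have "h (csqrt (w\<^sup>2)) = h w" if "cmod w \<le> 1" for w
    using disc_resolvent_unique[OF R', of "w\<^sup>2" "h w"] inv[OF that] that
    by (simp add: norm_power power_le_one)
  with R' show ?thesis using that unfolding h_def by blast
qed

text \<open>For selfadjoint elements the C*-identity says that squaring an element squares its norm,
  and repeated squaring reaches exactly the exponents \<open>2 ^ k\<close>.\<close>

lemma norm_selfadjoint_power:
  fixes b :: "'a::unital_cstar_algebra"
  assumes "b\<^sup>\<star> = b"
  shows "norm (b ^ (2 ^ k)) = norm b ^ (2 ^ k)"
proof (induction k)
  case (Suc k)
  have "norm (b ^ (2 ^ Suc k)) = norm ((b ^ (2 ^ k))\<^sup>\<star> * b ^ (2 ^ k))"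
    by (simp add: adj_power assms flip: power_add mult_2)
  also have "\<dots> = norm b ^ (2 ^ Suc k)"
    by (simp add: cstar_identity Suc flip: power_mult) (simp add: mult.commute)
  finally show ?case .
qed simp

text \<open>Rickart's elementary form of the spectral radius formula. Averaging the resolvent over
  \<open>\<plusminus>w\<close> gives the resolvent of \<open>b\<^sup>2\<close> without enlarging the oscillation between the unit
  circle and a smaller circle, whose radius \<open>r ^ 2 ^ k\<close> tends to 0.\<close>

lemma no_disc_resolvent:
  fixes b :: "'a::unital_cstar_algebra"
  assumes "b\<^sup>\<star> = b" "norm b = 1" and R: "disc_resolvent b R"
  shows False
proof -
  have "uniformly_continuous_on (cball 0 1) R"
    using disc_resolvent_continuous[OF R] compact_cball by (rule compact_uniformly_continuous)
  then obtain d where d: "d > 0"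
    and dR: "\<And>z w. z \<in> cball 0 1 \<Longrightarrow> w \<in> cball 0 1 \<Longrightarrow> dist w z < d \<Longrightarrow> dist (R w) (R z) < 1/8"
    unfolding uniformly_continuous_on_def by (metis zero_less_divide_1_iff zero_less_numeral)
  define r where "r = max 0 (1 - d / 2)"
  have r: "0 \<le> r" "r < 1" "1 - r < d" using d by (auto simp: r_def)
  have base: "norm (R z - R (of_real r * z)) \<le> 1/8" if "cmod z = 1" for z
  proof -
    have "dist z (of_real r * z) = cmod (of_real (1 - r) * z)"
      by (simp add: dist_norm left_diff_distrib)
    also have "\<dots> = 1 - r" using r that unfolding norm_mult norm_of_real by simp
    also have "\<dots> < d" by fact
    finally show ?thesis
      using dR[of "of_real r * z" z] that r by (simp add: dist_norm norm_mult less_imp_le)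
  qed
  have step: "\<exists>R'. disc_resolvent (b ^ (2 ^ k)) R' \<and>
      (\<forall>z. cmod z = 1 \<longrightarrow> norm (R' z - R' (of_real (r ^ (2 ^ k)) * z)) \<le> 1/8)" for k
  proof (induction k)
    case 0
    then show ?case using R base by auto
  next
    case (Suc k)
    then obtain R1 where R1: "disc_resolvent (b ^ (2 ^ k)) R1" and
      osc: "\<And>z. cmod z = 1 \<Longrightarrow> norm (R1 z - R1 (of_real (r ^ (2 ^ k)) * z)) \<le> 1/8" by blast
    obtain R2 where R2: "disc_resolvent ((b ^ (2 ^ k))\<^sup>2) R2"
      and avg: "\<And>w. cmod w \<le> 1 \<Longrightarrow> R2 (w\<^sup>2) = (1/2) *\<^sub>R (R1 w + R1 (- w))"
      using disc_resolvent_square[OF R1] by blast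
    define q where "q = complex_of_real (r ^ (2 ^ k))"
    have q: "cmod q \<le> 1" using r by (simp add: q_def power_le_one norm_power)
    have "norm (R2 z - R2 (of_real (r ^ (2 ^ Suc k)) * z)) \<le> 1/8" if z: "cmod z = 1" for z
    proof -
      define w where "w = csqrt z"
      have w: "cmod w = 1" "z = w\<^sup>2" using z by (simp_all add: w_def norm_csqrt)
      have "of_real (r ^ (2 ^ Suc k)) * z = (q * w)\<^sup>2"
        by (simp add: q_def w power_mult_distrib mult.commute flip: power_mult)
      moreover have "R2 z = (1/2) *\<^sub>R (R1 w + R1 (- w))" using avg[of w] w by simp
      moreover have "R2 ((q * w)\<^sup>2) = (1/2) *\<^sub>R (R1 (q * w) + R1 (q * (- w)))"
        using avg[of "q * w"] w q by (simp add: norm_mult)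
      ultimately have "R2 z - R2 (of_real (r ^ (2 ^ Suc k)) * z)
          = (1/2) *\<^sub>R ((R1 w - R1 (q * w)) + (R1 (- w) - R1 (q * (- w))))"
        by (simp add: algebra_simps)
      then have "norm (R2 z - R2 (of_real (r ^ (2 ^ Suc k)) * z))
          = 1/2 * norm ((R1 w - R1 (q * w)) + (R1 (- w) - R1 (q * (- w))))"
        by simp
      also have "\<dots> \<le> 1/2 * (norm (R1 w - R1 (q * w)) + norm (R1 (- w) - R1 (q * (- w))))"
        by (intro mult_left_mono norm_triangle_ineq) simp
      also have "\<dots> \<le> 1/2 * (1/8 + 1/8)"
        using w osc[of w] osc[of "- w"] unfolding q_def by (intro mult_left_mono add_mono) auto
      finally show ?thesis by simp
    qed
    with R2 show ?case by (auto simp: mult.commute simp flip: power_mult)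
  qed
  have "(\<lambda>n. r ^ n) \<longlonglongrightarrow> 0" using r by (simp add: LIMSEQ_realpow_zero)
  then have "eventually (\<lambda>n. r ^ n < 1/8) sequentially"
    by (rule order_tendstoD) simp
  then obtain N where N: "\<And>n. n \<ge> N \<Longrightarrow> r ^ n < 1/8" by (auto simp: eventually_sequentially)
  have rN: "r ^ (2 ^ N) < 1/8" using N[of "2 ^ N"] less_exp[of N] by simp
  obtain R' where R': "disc_resolvent (b ^ (2 ^ N)) R'"
    and osc: "norm (R' 1 - R' (of_real (r ^ (2 ^ N)))) \<le> 1/8"
    using step[of N] by (metis mult.right_neutral norm_one)
  \<comment> \<open>Since \<open>norm c = 1\<close> and \<open>q < 1/8\<close>, the resolvent value
    \<open>u\<close> lies within 1/7 of 1; the oscillation adds 1/8, so the inverse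
    \<open>1 + e\<close> of \<open>1 - c\<close> is within 15/56 of 1. Expanding (1 - c)(1 + e) = 1
    gives \<open>c = e - c * e\<close>, whose norm is at most 30/56, against
    \<open>norm c = 1\<close>.\<close>
  define c where "c = b ^ (2 ^ N)"
  define q where "q = r ^ (2 ^ N)"
  define e where "e = R' 1 - 1"
  define u where "u = R' (of_real q)"
  have c: "norm c = 1" by (simp add: c_def norm_selfadjoint_power assms)
  have q: "0 \<le> q" "q < 1/8" using r rN by (simp_all add: q_def)
  have "(1 - q *\<^sub>R c) * u = 1" using R' q by (simp add: disc_resolvent_def c_def u_def scaleR_scaleC)
  then have u1: "u - 1 = q *\<^sub>R (c * u)" by (simp add: algebra_simps)
  have "norm (u - 1) \<le> 1/8 * norm u"
    unfolding u1 norm_scaleR using q norm_mult_ineq[of c u] c by (intro mult_mono) auto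
  then have "norm (u - 1) \<le> 1/7" using norm_triangle_ineq[of "u - 1" 1] by simp
  moreover have "norm (R' 1 - u) \<le> 1/8" using osc by (simp add: u_def q_def)
  ultimately have e: "norm e \<le> 15/56"
    using norm_triangle_ineq[of "R' 1 - u" "u - 1"] by (simp add: e_def)
  have "(1 - 1 *\<^sub>C c) * R' 1 = 1" using R'[unfolded disc_resolvent_def, rule_format, of 1] by (simp add: c_def)
  then have "c = e - c * e" by (simp add: e_def algebra_simps)
  then have "norm c \<le> norm e + norm (c * e)" by (metis norm_triangle_ineq4)
  also have "norm (c * e) \<le> norm e" using norm_mult_ineq[of c e] c by simp
  finally show False using c e by simp
qed

text \<open>If the norm of \<open>x\<close> grew, scale the square of its modulus so that the image
  has norm exactly 1. The preimage then has norm below 1, so the Neumann series gives it a resolvent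
  on the closed disc. The homomorphism carries this over to a selfadjoint element of norm 1, which
  cannot have one.\<close>

lemma unital_star_hom_contractive:
  fixes \<phi> :: "'a::unital_cstar_algebra \<Rightarrow> 'b::unital_cstar_algebra"
  assumes "unital_star_hom \<phi>"
  shows "norm (\<phi> x) \<le> norm x"
proof (rule ccontr)
  have h: "\<phi> (x + y) = \<phi> x + \<phi> y" "\<phi> (c *\<^sub>C x) = c *\<^sub>C \<phi> x"
    "\<phi> (x * y) = \<phi> x * \<phi> y" "\<phi> (x\<^sup>\<star>) = (\<phi> x)\<^sup>\<star>" "\<phi> 1 = 1" for x y c
    using assms by (auto simp: unital_star_hom_def star_hom_def)
  have d: "\<phi> (x - y) = \<phi> x - \<phi> y" for x y
    using h(1)[of "x - y" y] by (simp add: algebra_simps)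
  assume "\<not> ?thesis"
  then have less: "norm x < norm (\<phi> x)" by simp
  define n where "n = norm (\<phi> x)"
  have n: "n > 0" using le_less_trans[OF norm_ge_zero less] by (simp add: n_def)
  define a where "a = (1 / n\<^sup>2) *\<^sub>R (x\<^sup>\<star> * x)"
  have \<phi>a: "\<phi> a = (1 / n\<^sup>2) *\<^sub>R ((\<phi> x)\<^sup>\<star> * \<phi> x)" by (simp only: a_def scaleR_scaleC h)
  have "norm a = (norm x / n)\<^sup>2" using n by (simp add: a_def cstar_identity power_divide)
  also have "\<dots> < 1" using less n by (simp add: n_def power_less_one_iff)
  finally have a: "norm a < 1" .
  have "\<exists>y. (1 - z *\<^sub>C a) * y = 1 \<and> y * (1 - z *\<^sub>C a) = 1" if "cmod z \<le> 1" for z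
  proof -
    have "norm (z *\<^sub>C a) < 1"
      using a that mult_left_le_one_le[of "norm a" "cmod z"] by simp
    then show ?thesis by (meson neumann_inverse)
  qed
  then obtain Q where Q: "\<And>z. cmod z \<le> 1 \<Longrightarrow> (1 - z *\<^sub>C a) * Q z = 1 \<and> Q z * (1 - z *\<^sub>C a) = 1"
    by metis
  have "disc_resolvent (\<phi> a) (\<lambda>z. \<phi> (Q z))"
    unfolding disc_resolvent_def using Q by (metis d h(2,3,5))
  moreover have "(\<phi> a)\<^sup>\<star> = \<phi> a" by (simp add: \<phi>a adj_scaleR adj_mult adj_adj)
  moreover have "norm (\<phi> a) = 1" using n by (simp add: \<phi>a cstar_identity n_def)
  ultimately show False using no_disc_resolvent by blast
qed

lemma unital_star_hom_automorphism:
  assumes "star_automorphism \<phi>"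
  shows "unital_star_hom \<phi>"
proof -
  have m: "\<phi> (x * y) = \<phi> x * \<phi> y" and b: "bij \<phi>" for x y
    using assms by (auto simp: star_automorphism_def star_hom_def)
  obtain u where u: "\<phi> u = 1" using bij_is_surj[OF b] by (metis surjD)
  have "\<phi> 1 = \<phi> u * \<phi> 1" by (simp add: u)
  also have "\<dots> = 1" using m[of u 1] u by simp
  finally show ?thesis using assms by (simp add: unital_star_hom_def star_automorphism_def)
qed

subsection \<open>Continuity of states\<close>

lemma summable_norm_binomial_series:
  fixes h :: "'a::{real_normed_algebra_1,banach}"
  assumes "norm h < 1"
  shows "summable (\<lambda>n. norm (((1/2::real) gchoose n) *\<^sub>R h ^ n))"
proof (rule summable_comparison_test')
  have "ereal (norm (norm h)) < conv_radius (\<lambda>n. (1/2::real) gchoose n)"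
    using assms by (simp add: conv_radius_gchoose one_ereal_def)
  then show "summable (\<lambda>n. norm (((1/2::real) gchoose n) * norm h ^ n))"
    by (rule abs_summable_in_conv_radius)
  show "norm (norm (((1/2::real) gchoose n) *\<^sub>R h ^ n)) \<le> norm (((1/2::real) gchoose n) * norm h ^ n)"
    if "n \<ge> 0" for n
    by (auto simp: abs_mult intro!: mult_left_mono norm_power_ineq)
qed

text \<open>The binomial series of exponent 1/2 has real coefficients and converges absolutely. By
  Vandermonde its Cauchy square has the coefficients \<open>1 gchoose k\<close>, which vanish from
  \<open>k = 2\<close> on.\<close>

lemma selfadjoint_sqrt:
  fixes h :: "'a::unital_cstar_algebra"
  assumes "h\<^sup>\<star> = h" "norm h < 1"
  obtains b where "b\<^sup>\<star> = b" "b * b = 1 + h"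
proof
  define a where "a n = ((1/2::real) gchoose n) *\<^sub>R h ^ n" for n
  have S: "summable (\<lambda>n. norm (a n))"
    using summable_norm_binomial_series[OF assms(2)] by (simp add: a_def)
  then have S': "summable a" by (rule summable_norm_cancel)
  have "(suminf a)\<^sup>\<star> = suminf (\<lambda>n. (a n)\<^sup>\<star>)"
    using bounded_linear.suminf[OF bounded_linear_adj S'] by simp
  moreover have "(a n)\<^sup>\<star> = a n" for n by (simp add: a_def adj_scaleR adj_power assms)
  ultimately show "(suminf a)\<^sup>\<star> = suminf a" by simp
  have "(\<Sum>i\<le>k. a i * a (k - i)) = ((1::real) gchoose k) *\<^sub>R h ^ k" for k
  proof -
    have "(\<Sum>i\<le>k. a i * a (k - i))
        = (\<Sum>i\<le>k. ((1/2::real) gchoose i) * ((1/2) gchoose (k - i))) *\<^sub>R h ^ k"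
      unfolding scaleR_sum_left a_def
      by (rule sum.cong) (simp_all add: mult.commute flip: power_add)
    also have "(\<Sum>i\<le>k. ((1/2::real) gchoose i) * ((1/2) gchoose (k - i))) = 1 gchoose k"
      using gbinomial_Vandermonde[of "1/2::real" "1/2" k] by (simp add: atMost_atLeast0)
    finally show ?thesis .
  qed
  then have "(\<lambda>k. ((1::real) gchoose k) *\<^sub>R h ^ k) sums (suminf a * suminf a)"
    using Cauchy_product_sums[OF S S] by simp
  moreover have "(\<lambda>k. ((1::real) gchoose k) *\<^sub>R h ^ k) sums (\<Sum>k<2. ((1::real) gchoose k) *\<^sub>R h ^ k)"
  proof (rule sums_finite)
    fix k :: nat assume "k \<notin> {..<2}"
    then have "(1::nat) choose k = 0" by (intro binomial_eq_0) auto
    then show "((1::real) gchoose k) *\<^sub>R h ^ k = 0"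
      using binomial_gbinomial[of 1 k, where 'a = real] by (metis of_nat_0 of_nat_1 scaleR_zero_left)
  qed simp
  ultimately show "suminf a * suminf a = 1 + h"
    by (simp add: sums_unique2 numeral_2_eq_2)
qed

text \<open>For selfadjoint \<open>h\<close> of norm below 1 both 1 + h and 1 - h are squares of
  selfadjoint elements, so positivity confines \<omega>(h) to the interval from -1 to 1. The factor
  2 comes from estimating the real and imaginary parts of \<open>x\<close> separately.\<close>

lemma state_norm_le:
  assumes "state \<omega>"
  shows "cmod (\<omega> x) \<le> 2 * norm x"
proof -
  have lin: "\<omega> (x + y) = \<omega> x + \<omega> y" "\<omega> (c *\<^sub>C x) = c * \<omega> x"
    and pos: "\<omega> (x\<^sup>\<star> * x) \<in> \<real>\<^sub>\<ge>\<^sub>0" and one: "\<omega> 1 = 1" for x y c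
    using assms by (auto simp: state_def)
  have bound1: "cmod (\<omega> h) \<le> 1" if h: "h\<^sup>\<star> = h" "norm h < 1" for h
  proof -
    have "1 + \<omega> k \<in> \<real>\<^sub>\<ge>\<^sub>0" if k: "k\<^sup>\<star> = k" "norm k < 1" for k
    proof -
      obtain b where "b\<^sup>\<star> = b" "b * b = 1 + k" using selfadjoint_sqrt[OF k] by blast
      then show ?thesis using pos[of b] by (simp add: lin one)
    qed
    from this[of h] this[of "- h"] have "1 + \<omega> h \<in> \<real>\<^sub>\<ge>\<^sub>0" "1 - \<omega> h \<in> \<real>\<^sub>\<ge>\<^sub>0"
      using h lin(2)[of "-1" h] by (simp_all add: adj_minus)
    then show ?thesis
      by (auto simp: complex_nonneg_Reals_iff cmod_def)
  qed
  have bound: "cmod (\<omega> h) \<le> norm h" if h: "h\<^sup>\<star> = h" for h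
  proof (rule field_le_epsilon)
    fix e :: real assume e: "e > 0"
    define m where "m = norm h + e"
    have m: "m > 0" "norm h < m" using e by (simp_all add: m_def add_nonneg_pos)
    have "cmod (\<omega> ((1/m) *\<^sub>R h)) \<le> 1"
      using m h by (intro bound1) (simp_all add: adj_scaleR)
    then show "cmod (\<omega> h) \<le> norm h + e"
      using m by (simp add: scaleR_scaleC lin norm_mult norm_divide field_simps) (simp add: m_def)
  qed
  define h where "h = (1/2) *\<^sub>C (x + x\<^sup>\<star>)"
  define k where "k = (- \<i>/2) *\<^sub>C (x - x\<^sup>\<star>)"
  have sa: "h\<^sup>\<star> = h" "k\<^sup>\<star> = k"
    by (simp_all add: h_def k_def adj_scaleC adj_add adj_diff adj_adj add.commute
        complex_vector.scale_right_diff_distrib)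
  have nrm: "norm h \<le> norm x" "norm k \<le> norm x"
    using norm_triangle_ineq[of x "x\<^sup>\<star>"] norm_triangle_ineq4[of x "x\<^sup>\<star>"]
    by (simp_all add: h_def k_def norm_divide)
  have "h + \<i> *\<^sub>C k = (1/2) *\<^sub>C ((x + x\<^sup>\<star>) + (x - x\<^sup>\<star>))"
    by (simp only: h_def k_def scaleC_scaleC scaleC_add_right) simp
  also have "\<dots> = (1/2) *\<^sub>C (2 *\<^sub>C x)"
    using scaleC_add_left[of 1 1 x] by simp
  also have "\<dots> = x" by (simp only: scaleC_scaleC) simp
  finally have "\<omega> x = \<omega> h + \<i> * \<omega> k" using lin by metis
  then have "cmod (\<omega> x) \<le> cmod (\<omega> h) + cmod (\<omega> k)"
    using norm_triangle_ineq[of "\<omega> h" "\<i> * \<omega> k"] by (simp add: norm_mult)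
  with bound[OF sa(1)] bound[OF sa(2)] nrm show ?thesis by linarith
qed

subsection \<open>Isometries in AF-algebras\<close>

lemma norm_isometry:
  fixes v :: "'a::unital_cstar_algebra"
  assumes "v\<^sup>\<star> * v = 1"
  shows "norm v = 1"
  using cstar_identity[of v] assms by (simp add: power2_eq_1_iff) (smt (verit) norm_ge_zero)

text \<open>An element of the subalgebra that is left invertible in the whole algebra acts injectively,
  hence surjectively, on the finite-dimensional subalgebra by left multiplication.\<close>

lemma finite_dimensional_left_mult_surj:
  fixes B :: "'a::unital_cstar_algebra set"
  assumes B: "star_subalgebra B" "finite_dimensional B" and y: "y \<in> B" "z * y = 1" and b: "b \<in> B"
  obtains c where "c \<in> B" "y * c = b"
proof -
  have sub: "complex_vector.subspace B" using B by (simp add: star_subalgebra_def)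
  have ymul: "(\<lambda>x. y * x) ` B \<subseteq> B" using B y by (auto simp: star_subalgebra_def)
  have linear: "Vector_Spaces.linear scaleC scaleC (\<lambda>x. y * x)"
    by unfold_locales (simp_all add: distrib_left mult_scaleC_right)
  have inj: "inj_on (\<lambda>x. y * x) X" for X
    by (rule inj_onI) (metis y(2) mult.assoc mult_1_left)
  interpret vp: vector_space_pair "scaleC :: complex \<Rightarrow> 'a \<Rightarrow> 'a" "scaleC :: complex \<Rightarrow> 'a \<Rightarrow> 'a" ..
  obtain T where T: "finite T" "B \<subseteq> complex_vector.span T"
    using B by (auto simp: finite_dimensional_def)
  obtain C where C: "C \<subseteq> B" "complex_vector.independent C" "B \<subseteq> complex_vector.span C"
    using complex_vector.basis_exists[of B] by metis
  have spanC: "complex_vector.span C = B"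
    using C sub complex_vector.span_minimal by blast
  have finC: "finite C" "card C \<le> card T" if "complex_vector.independent C" "C \<subseteq> B" for C
    using complex_vector.independent_span_bound[OF T(1) that(1)] that T by auto
  let ?I = "(\<lambda>x. y * x) ` C"
  have I: "complex_vector.independent ?I"
    by (rule vp.linear_independent_injective_image[OF linear C(2) inj])
  have IB: "?I \<subseteq> B" using C ymul by auto
  have cardI: "card ?I = card C" by (rule card_image[OF inj])
  have "B \<subseteq> complex_vector.span ?I"
  proof (rule ccontr)
    assume "\<not> ?thesis"
    then obtain x where x: "x \<in> B" "x \<notin> complex_vector.span ?I" by blast
    then have ind: "complex_vector.independent (insert x ?I)"
      using I complex_vector.independent_insert complex_vector.span_base by (metis (no_types, lifting))
    have "card (insert x ?I) \<le> card C"
      using complex_vector.independent_span_bound[OF finC(1)[OF C(2,1)] ind] x IB spanC by auto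
    moreover have "x \<notin> ?I" using x(2) complex_vector.span_base[of x ?I] by blast
    moreover have "finite ?I" using finC(1)[OF C(2,1)] by (rule finite_imageI)
    ultimately show False unfolding cardI[symmetric] by (simp add: card_insert_disjoint)
  qed
  also have "complex_vector.span ?I = (\<lambda>x. y * x) ` complex_vector.span C"
    by (rule vp.linear_span_image[OF linear])
  finally have "B \<subseteq> (\<lambda>x. y * x) ` B" by (simp only: spanC)
  with b have "b \<in> (\<lambda>x. y * x) ` B" by (rule rev_subsetD)
  then show ?thesis using that by auto
qed

text \<open>An approximant \<open>x\<close> of \<open>v\<close> in some \<open>F n\<close> is left
  invertible, and finite dimension makes it right invertible with inverse \<open>z\<close> of
  controlled norm. The defect projection \<open>q\<close> annihilates \<open>v\<close> from the
  left, so q = q x z = q (x - v) z has norm below 1, whereas a nonzero projection has norm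
  1.\<close>

lemma AF_isometry_unitary:
  fixes v :: "'a::unital_cstar_algebra"
  assumes AF: "AF_algebra B" and v: "v \<in> B" "v\<^sup>\<star> * v = 1"
  shows "v * v\<^sup>\<star> = 1"
proof -
  from AF[unfolded AF_algebra_def] obtain F :: "nat \<Rightarrow> 'a set" where
    F: "\<forall>n. star_subalgebra (F n) \<and> finite_dimensional (F n)" and B: "B = closure (\<Union>n. F n)"
    by (elim exE conjE)
  have F: "star_subalgebra (F n)" "finite_dimensional (F n)" for n
    using F by auto
  have "\<exists>x\<in>\<Union>n. F n. dist x v < 1/8"
    by (rule closure_approachable[THEN iffD1, rule_format]) (use v(1) B in auto)
  then obtain n x where x: "x \<in> F n" "norm (x - v) < 1/8" by (auto simp: dist_norm)
  have nv: "norm v = 1" using v(2) by (rule norm_isometry)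
  have nx: "norm x \<le> 9/8" using norm_triangle_ineq[of "x - v" v] x nv by simp
  define h where "h = 1 - x\<^sup>\<star> * x"
  have "h = (v - x)\<^sup>\<star> * v + x\<^sup>\<star> * (v - x)"
    by (simp add: h_def adj_diff algebra_simps v)
  then have "norm h \<le> norm ((v - x)\<^sup>\<star> * v) + norm (x\<^sup>\<star> * (v - x))"
    by (simp add: norm_triangle_ineq)
  also have "norm ((v - x)\<^sup>\<star> * v) \<le> 1/8"
    using norm_mult_ineq[of "(v - x)\<^sup>\<star>" v] nv x by (simp add: norm_minus_commute)
  also have "norm (x\<^sup>\<star> * (v - x)) \<le> 9/8 * (1/8)"
    using nx x by (intro order_trans[OF norm_mult_ineq] mult_mono) (auto simp: norm_minus_commute)
  finally have h: "norm h \<le> 17/64" by simp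
  then have "norm h < 1" by simp
  then obtain y where y: "(1 - h) * y = 1" "y * (1 - h) = 1" by (rule neumann_inverse)
  have yx: "y * x\<^sup>\<star> * x = 1" using y(2) by (simp add: h_def mult.assoc)
  have xx: "x\<^sup>\<star> * x \<in> F n" using F x by (simp add: star_subalgebra_def)
  have yxx: "y * (x\<^sup>\<star> * x) = 1" using y(2) by (simp add: h_def)
  \<comment> \<open>\<open>F n\<close> is not assumed to contain 1. Solving this equation inside
    \<open>F n\<close> and cancelling the left invertible factor shows that the solution is
    1.\<close>
  obtain e where e: "e \<in> F n" "x\<^sup>\<star> * x * e = x\<^sup>\<star> * x"
    using F xx yxx xx by (rule finite_dimensional_left_mult_surj)
  have "y * (x\<^sup>\<star> * x) * e = y * (x\<^sup>\<star> * x)" unfolding mult.assoc[of y] e(2) ..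
  then have "e = 1" unfolding yxx by simp
  then have one: "1 \<in> F n" using e by simp
  obtain z where z: "x * z = 1"
    using F x(1) yx one by (rule finite_dimensional_left_mult_surj)
  have "z = y * x\<^sup>\<star> * (x * z)" using yx by (simp flip: mult.assoc)
  then have zy: "z = y * x\<^sup>\<star>" using z by simp
  have "y = 1 + h * y" using y(1) by (simp add: algebra_simps)
  then have "norm y \<le> norm (1::'a) + norm (h * y)" by (metis norm_triangle_ineq)
  also have "norm (h * y) \<le> 17/64 * norm y"
    using h by (intro order_trans[OF norm_mult_ineq] mult_right_mono) auto
  finally have ny: "norm y \<le> 64/47" by simp
  have nz: "norm z \<le> 64/47 * (9/8)"
    unfolding zy using ny nx by (intro order_trans[OF norm_mult_ineq] mult_mono) auto
  define q where "q = 1 - v * v\<^sup>\<star>"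
  have qv: "q * v = 0" by (simp add: q_def left_diff_distrib mult.assoc v)
  have "q * (1 - v * v\<^sup>\<star>) = q - q * v * v\<^sup>\<star>" by (simp add: right_diff_distrib mult.assoc)
  then have "q * q = q" by (simp only: qv flip: q_def) simp
  moreover have "q\<^sup>\<star> = q" by (simp add: q_def adj_diff adj_mult adj_adj)
  ultimately have "norm q = (norm q)\<^sup>2" using cstar_identity[of q] by simp
  then have nq: "norm q = 0 \<or> norm q = 1" by (simp add: power2_eq_square)
  have "q = q * (x * z)" using z by simp
  also have "\<dots> = q * (x - v) * z" by (simp add: right_diff_distrib mult.assoc[symmetric] qv)
  finally have "norm q \<le> norm (q * (x - v)) * norm z" by (metis norm_mult_ineq)
  also have "norm (q * (x - v)) \<le> 1 * (1/8)"
    using nq x by (intro order_trans[OF norm_mult_ineq] mult_mono) auto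
  finally have "norm q \<le> 1/8 * norm z" by (simp add: mult_right_mono)
  with nz have "norm q < 1" by simp
  with nq have "q = 0" by simp
  then show ?thesis by (simp add: q_def)
qed

subsection \<open>The invariant state of a weight vector\<close>

locale cuntz_family =
  fixes s :: "'d::finite \<Rightarrow> 'a::unital_cstar_algebra"
  assumes card: "2 \<le> CARD('d)" and cuntz: "cuntz_algebra s"
begin

lemma orthogonal: "(s i)\<^sup>\<star> * s j = (if i = j then 1 else 0)"
  and sum_range_projections: "(\<Sum>j\<in>UNIV. s j * (s j)\<^sup>\<star>) = 1"
  and dense: "closure (range (eval_free s)) = UNIV"
  using cuntz by (auto simp: cuntz_algebra_def cuntz_relations_def)

lemma orthogonal': "(s i)\<^sup>\<star> * (s j * x) = (if i = j then x else 0)"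
  using orthogonal by (simp flip: mult.assoc)

lemma norm_gen: "norm (s j) = 1"
  by (rule norm_isometry) (simp add: orthogonal)

lemma ex_other_index: "\<exists>k. k \<noteq> (j::'d)"
proof (rule ccontr)
  assume "\<not> ?thesis"
  then have "(UNIV::'d set) = {j}" by auto
  then have "CARD('d) = 1" by (metis card_1_singleton_iff One_nat_def)
  then show False using card by simp
qed

section \<open>Words in the generators and the spanning monomials\<close>

definition gen_word :: "'d list \<Rightarrow> 'a" where
  "gen_word \<mu> = prod_list (map s \<mu>)"

lemma gen_word_simps [simp]:
  "gen_word [] = 1"
  "gen_word (j # \<mu>) = s j * gen_word \<mu>"
  "gen_word (\<mu> @ \<nu>) = gen_word \<mu> * gen_word \<nu>"
  by (simp_all add: gen_word_def)

text \<open>Equal first letters cancel. What is left when this stops is the rest of one word, or two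
  different leading letters, whose product is 0. This is the only multiplication rule used for
  monomials.\<close>

lemma gen_word_adj_mult_cases:
  obtains \<kappa> where "\<nu> = \<mu> @ \<kappa>" "(gen_word \<mu>)\<^sup>\<star> * gen_word \<nu> = gen_word \<kappa>"
  | \<kappa> where "\<mu> = \<nu> @ \<kappa>" "(gen_word \<mu>)\<^sup>\<star> * gen_word \<nu> = (gen_word \<kappa>)\<^sup>\<star>"
  | "(gen_word \<mu>)\<^sup>\<star> * gen_word \<nu> = 0" "\<mu> \<noteq> \<nu>"
proof -
  have "(\<exists>\<kappa>. \<nu> = \<mu> @ \<kappa> \<and> (gen_word \<mu>)\<^sup>\<star> * gen_word \<nu> = gen_word \<kappa>) \<or>
      (\<exists>\<kappa>. \<mu> = \<nu> @ \<kappa> \<and> (gen_word \<mu>)\<^sup>\<star> * gen_word \<nu> = (gen_word \<kappa>)\<^sup>\<star>) \<or>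
      ((gen_word \<mu>)\<^sup>\<star> * gen_word \<nu> = 0 \<and> \<mu> \<noteq> \<nu>)"
  proof (induction \<mu> arbitrary: \<nu>)
    case (Cons a \<mu>)
    show ?case
    proof (cases \<nu>)
      case (Cons b \<nu>')
      have "(gen_word (a # \<mu>))\<^sup>\<star> * gen_word \<nu> = (if a = b then (gen_word \<mu>)\<^sup>\<star> * gen_word \<nu>' else 0)"
        by (simp add: Cons adj_mult mult.assoc orthogonal')
      with Cons.IH[of \<nu>'] Cons show ?thesis by auto
    qed simp
  qed simp
  with that show ?thesis by blast
qed

definition monomial :: "'d list \<Rightarrow> 'd list \<Rightarrow> 'a" where
  "monomial \<mu> \<nu> = gen_word \<mu> * (gen_word \<nu>)\<^sup>\<star>"

abbreviation monomials :: "'a set" where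
  "monomials \<equiv> {monomial \<mu> \<nu> |\<mu> \<nu>. True}"

text \<open>Letters are multiplied on from the left. A generator extends \<mu>; an adjoint letter
  cancels the head of \<mu> or gives 0, and if \<mu> is empty it is appended to \<nu>, because
  taking adjoints reverses products.\<close>

lemma eval_word_monomial:
  "eval_word s w \<in> insert 0 monomials"
proof -
  let ?M = "insert 0 monomials"
  have mono: "monomial \<mu> \<nu> \<in> ?M" for \<mu> \<nu> by auto
  have gen: "s j * x \<in> ?M" if "x \<in> ?M" for j x
  proof -
    have "s j * monomial \<mu> \<nu> = monomial (j # \<mu>) \<nu>" for \<mu> \<nu>
      by (simp add: monomial_def mult.assoc)
    then have "s j * monomial \<mu> \<nu> \<in> ?M" for \<mu> \<nu> using mono by simp
    then show ?thesis using that by auto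
  qed
  have adj: "(s j)\<^sup>\<star> * x \<in> ?M" if x: "x \<in> ?M" for j x
  proof -
    have "(s j)\<^sup>\<star> * monomial \<mu> \<nu> \<in> ?M" for \<mu> \<nu>
    proof (cases \<mu>)
      case Nil
      then have "(s j)\<^sup>\<star> * monomial \<mu> \<nu> = monomial [] (\<nu> @ [j])"
        by (simp add: monomial_def adj_mult)
      then show ?thesis using mono by metis
    next
      case (Cons a \<mu>')
      then have "(s j)\<^sup>\<star> * monomial \<mu> \<nu> = (if j = a then monomial \<mu>' \<nu> else 0)"
        by (simp add: monomial_def mult.assoc orthogonal')
      then show ?thesis using mono by auto
    qed
    then show ?thesis using x by auto
  qed
  have "prod_list (map (eval_letter s) ls) \<in> ?M" for ls
  proof (induction ls)
    case Nil
    show ?case using mono[of "[]" "[]"] by (simp add: monomial_def)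
  next
    case (Cons l ls)
    then show ?case using gen adj by (cases l) auto
  qed
  then show ?thesis by (simp add: eval_word_def)
qed

lemma eval_free_span: "eval_free s f \<in> complex_vector.span monomials"
proof (induction f rule: free_star_algebra_induct)
  case (add f w c)
  have "eval_word s w \<in> complex_vector.span monomials"
    using eval_word_monomial[of w] complex_vector.span_base complex_vector.span_zero
    by (metis (no_types, lifting) insertE)
  then show ?case
    unfolding eval_free_add eval_free_single
    by (intro complex_vector.span_add complex_vector.span_scale add)
qed (simp add: complex_vector.span_zero)

lemma span_monomials_dense: "closure (complex_vector.span monomials) = UNIV"
proof -
  have "closure (range (eval_free s)) \<subseteq> closure (complex_vector.span monomials)"
    using eval_free_span by (intro closure_mono) auto
  then show ?thesis using dense by auto
qed

end

lemma sum_nonneg_Reals: "(\<And>i. i \<in> A \<Longrightarrow> f i \<in> \<real>\<^sub>\<ge>\<^sub>0) \<Longrightarrow> sum f A \<in> \<real>\<^sub>\<ge>\<^sub>0"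
  by (induction A rule: infinite_finite_induct) auto

section \<open>The averaging map of a weight vector and the convergence of its iterates\<close>

locale cuntz_weights = cuntz_family s for s :: "'d::finite \<Rightarrow> 'a::unital_cstar_algebra" +
  fixes p :: "'d \<Rightarrow> real"
  assumes p_pos: "p j > 0" and p_sum: "(\<Sum>j\<in>UNIV. p j) = 1"
begin

text \<open>A second generator exists and takes a positive share of the total weight. The strict
  bound is the source of all decay below.\<close>

lemma p_less_1: "p j < 1"
proof -
  obtain k where k: "k \<noteq> j" using ex_other_index by blast
  have "p j + p k = sum p {j, k}" using k by simp
  also have "\<dots> \<le> sum p UNIV" by (intro sum_mono2) (auto simp: p_pos less_imp_le)
  finally show ?thesis using p_sum p_pos[of k] by simp
qed

text \<open>A left inverse of the canonical endomorphism that sends \<open>x\<close> to the sum of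
  \<open>s j * x * (s j)\<^sup>\<star>\<close>; the weights single it out among such maps.\<close>

definition \<phi> :: "'a \<Rightarrow> 'a" where
  "\<phi> x = (\<Sum>j\<in>UNIV. p j *\<^sub>R ((s j)\<^sup>\<star> * x * s j))"

lemma \<phi>_add: "\<phi> (x + y) = \<phi> x + \<phi> y"
  by (simp add: \<phi>_def distrib_left distrib_right scaleR_add_right sum.distrib)

lemma \<phi>_scaleC: "\<phi> (c *\<^sub>C x) = c *\<^sub>C \<phi> x"
  by (simp add: \<phi>_def mult_scaleC_left mult_scaleC_right scaleR_scaleC scaleC_scaleC
      mult.commute complex_vector.scale_sum_right)

lemma \<phi>_adj: "\<phi> (x\<^sup>\<star>) = (\<phi> x)\<^sup>\<star>"
  by (simp add: \<phi>_def adj_sum adj_scaleR adj_mult adj_adj mult.assoc)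

lemma \<phi>_one: "\<phi> 1 = 1"
  by (simp add: \<phi>_def orthogonal p_sum flip: scaleR_sum_left)

lemma norm_\<phi>: "norm (\<phi> x) \<le> norm x"
proof -
  have "norm (\<phi> x) \<le> (\<Sum>j\<in>UNIV. p j * norm x)"
    unfolding \<phi>_def
  proof (rule sum_norm_le)
    fix j
    have "norm ((s j)\<^sup>\<star> * x * s j) \<le> norm ((s j)\<^sup>\<star> * x) * norm (s j)" by (rule norm_mult_ineq)
    also have "\<dots> \<le> norm x" using norm_mult_ineq[of "(s j)\<^sup>\<star>" x] by (simp add: norm_gen)
    finally show "norm (p j *\<^sub>R ((s j)\<^sup>\<star> * x * s j)) \<le> p j * norm x"
      using p_pos[of j] by simp
  qed
  then show ?thesis by (simp add: p_sum flip: sum_distrib_right)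
qed

text \<open>Orthogonality leaves one summand, so \<phi> moves a leading generator to the other end
  at the price \<open>p j\<close>. Invariance of the state under \<phi> turns this rotation into the
  KMS relation.\<close>

lemma \<phi>_gen_mult: "\<phi> (s j * x) = p j *\<^sub>R (x * s j)"
proof -
  have "\<phi> (s j * x) = (\<Sum>i\<in>UNIV. if i = j then p j *\<^sub>R (x * s j) else 0)"
    unfolding \<phi>_def by (rule sum.cong) (auto simp: orthogonal')
  then show ?thesis by simp
qed

lemma \<phi>_mult_adj_gen: "\<phi> (x * (s j)\<^sup>\<star>) = p j *\<^sub>R ((s j)\<^sup>\<star> * x)"
  using arg_cong[OF \<phi>_gen_mult[of j "x\<^sup>\<star>"], of adj]
  by (simp add: adj_mult adj_adj adj_scaleR flip: \<phi>_adj)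

lemma \<phi>_pow_add: "(\<phi> ^^ n) (x + y) = (\<phi> ^^ n) x + (\<phi> ^^ n) y"
  by (induction n) (simp_all add: \<phi>_add)

lemma \<phi>_pow_scaleC: "(\<phi> ^^ n) (c *\<^sub>C x) = c *\<^sub>C (\<phi> ^^ n) x"
  by (induction n) (simp_all add: \<phi>_scaleC)

lemma \<phi>_pow_adj: "(\<phi> ^^ n) (x\<^sup>\<star>) = ((\<phi> ^^ n) x)\<^sup>\<star>"
  by (induction n) (simp_all add: \<phi>_adj)

lemma \<phi>_pow_one: "(\<phi> ^^ n) 1 = 1"
  by (induction n) (simp_all add: \<phi>_one)

lemma \<phi>_pow_diff: "(\<phi> ^^ n) (x - y) = (\<phi> ^^ n) x - (\<phi> ^^ n) y"
  using \<phi>_pow_add[of n "x - y" y] by (simp add: algebra_simps)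

lemma norm_\<phi>_pow: "norm ((\<phi> ^^ n) x) \<le> norm x"
  by (induction n) (auto intro: order_trans[OF norm_\<phi>])

text \<open>A relation rather than a function, so that limits can be combined algebraically before
  convergence is known for every \<open>x\<close>.\<close>

definition ergodic_limit :: "'a \<Rightarrow> complex \<Rightarrow> bool" where
  "ergodic_limit x c \<longleftrightarrow> (\<lambda>n. (\<phi> ^^ n) x) \<longlonglongrightarrow> c *\<^sub>C 1"

lemma ergodic_limit_\<phi>: "ergodic_limit (\<phi> x) c \<longleftrightarrow> ergodic_limit x c"
  using filterlim_sequentially_Suc[of "\<lambda>n. (\<phi> ^^ n) x"]
  by (simp add: ergodic_limit_def funpow_swap1)

lemma ergodic_limit_add:
  "ergodic_limit x b \<Longrightarrow> ergodic_limit y c \<Longrightarrow> ergodic_limit (x + y) (b + c)"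
  unfolding ergodic_limit_def \<phi>_pow_add scaleC_add_left by (rule tendsto_add)

lemma ergodic_limit_scaleC: 
  assumes "ergodic_limit x b" shows "ergodic_limit (c *\<^sub>C x) (c * b)"
proof -
  have "continuous_on UNIV (\<lambda>x::'a. c *\<^sub>C x)" by (intro continuous_intros)
  then have "(\<lambda>n. c *\<^sub>C (\<phi> ^^ n) x) \<longlonglongrightarrow> c *\<^sub>C b *\<^sub>C 1"
    using assms unfolding ergodic_limit_def
    by (intro continuous_on_tendsto_compose[where s = UNIV and f = "\<lambda>x. c *\<^sub>C x"]) auto
  then show ?thesis by (simp add: ergodic_limit_def \<phi>_pow_scaleC scaleC_scaleC)
qed

lemma ergodic_limit_adj:
  assumes "ergodic_limit x c" shows "ergodic_limit (x\<^sup>\<star>) (cnj c)"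
proof -
  have "(\<lambda>n. ((\<phi> ^^ n) x)\<^sup>\<star>) \<longlonglongrightarrow> (c *\<^sub>C 1)\<^sup>\<star>"
    using assms unfolding ergodic_limit_def by (rule bounded_linear.tendsto[OF bounded_linear_adj])
  then show ?thesis by (simp add: ergodic_limit_def \<phi>_pow_adj adj_scaleC)
qed

lemma ergodic_limit_one: "ergodic_limit 1 1"
  by (simp add: ergodic_limit_def \<phi>_pow_one)

lemma ergodic_limit_norm_le:
  assumes "ergodic_limit x c" shows "cmod c \<le> norm x"
proof -
  have "norm (c *\<^sub>C (1::'a)) \<le> norm x"
    using assms unfolding ergodic_limit_def
    by (rule LIMSEQ_le_const2[OF tendsto_norm]) (simp add: norm_\<phi>_pow)
  then show ?thesis by simp
qed

lemma ergodic_limit_diff: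
  "ergodic_limit x b \<Longrightarrow> ergodic_limit y c \<Longrightarrow> ergodic_limit (x - y) (b - c)"
  using ergodic_limit_add[of x b "- y" "- c"] ergodic_limit_scaleC[of y c "-1"] by simp

lemma ergodic_limit_unique: "ergodic_limit x b \<Longrightarrow> ergodic_limit x c \<Longrightarrow> b = c"
  using ergodic_limit_norm_le[OF ergodic_limit_diff, of x b x c] by simp

text \<open>Each application of \<phi> rotates the word cyclically and multiplies it by the weight
  of the letter moved, at most \<open>q < 1\<close>. The word changes, so the induction must range
  over all nonempty words.\<close>

lemma ergodic_limit_gen_word:
  assumes "\<mu> \<noteq> []" shows "ergodic_limit (gen_word \<mu>) 0"
proof -
  define q where "q = Max (range p)"
  have q: "p j \<le> q" for j by (simp add: q_def)
  have "q \<in> range p" unfolding q_def by (intro Max_in) auto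
  then have q1: "0 \<le> q" "q < 1" using p_less_1 p_pos by (auto simp: less_imp_le)
  have "norm ((\<phi> ^^ n) (gen_word \<mu>)) \<le> q ^ n" if "\<mu> \<noteq> []" for n \<mu>
    using that
  proof (induction n arbitrary: \<mu>)
    case 0
    have "norm (gen_word \<mu>) \<le> 1" for \<mu>
    proof (induction \<mu>)
      case (Cons j \<mu>)
      then show ?case using norm_mult_ineq[of "s j" "gen_word \<mu>"] by (simp add: norm_gen)
    qed simp
    then show ?case by simp
  next
    case (Suc n)
    then obtain a \<nu> where \<mu>: "\<mu> = a # \<nu>" by (cases \<mu>) auto
    have "(\<phi> ^^ Suc n) (gen_word \<mu>) = complex_of_real (p a) *\<^sub>C (\<phi> ^^ n) (gen_word (\<nu> @ [a]))"
      unfolding funpow_Suc_right comp_def \<mu>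
      by (simp add: \<phi>_gen_mult scaleR_scaleC \<phi>_pow_scaleC)
    then have "norm ((\<phi> ^^ Suc n) (gen_word \<mu>)) = p a * norm ((\<phi> ^^ n) (gen_word (\<nu> @ [a])))"
      using p_pos[of a] by simp
    also have "\<dots> \<le> q * q ^ n"
      using Suc.IH[of "\<nu> @ [a]"] q[of a] p_pos[of a] q1 by (intro mult_mono) auto
    finally show ?case by simp
  qed
  from this[OF assms] have "(\<lambda>n. (\<phi> ^^ n) (gen_word \<mu>)) \<longlonglongrightarrow> 0"
    by (rule Lim_null_comparison[OF always_eventually[OF allI] LIMSEQ_realpow_zero[OF q1]])
  then show ?thesis by (simp add: ergodic_limit_def)
qed

text \<open>\<phi> strips the first letters of both words, with factor \<open>p b\<close> if they
  agree and 0 otherwise. Repetition ends with a pure word, an adjoint of one, or 1.\<close>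

lemma ergodic_limit_monomial: "\<exists>c. ergodic_limit (monomial \<mu> \<nu>) c"
proof (induction \<mu> arbitrary: \<nu>)
  case Nil
  then show ?case
    using ergodic_limit_adj[OF ergodic_limit_gen_word] ergodic_limit_one
    by (cases "\<nu> = []") (auto simp: monomial_def)
next
  case (Cons a \<mu>)
  show ?case
  proof (cases \<nu>)
    case Nil
    then show ?thesis using ergodic_limit_gen_word[of "a # \<mu>"] by (auto simp: monomial_def)
  next
    case (Cons b \<nu>')
    obtain c where c: "ergodic_limit (monomial \<mu> \<nu>') c" using Cons.IH by blast
    have "\<phi> (monomial (a # \<mu>) \<nu>) = p b *\<^sub>R (((s b)\<^sup>\<star> * (s a * gen_word \<mu>)) * (gen_word \<nu>')\<^sup>\<star>)"
      using \<phi>_mult_adj_gen[of "s a * gen_word \<mu> * (gen_word \<nu>')\<^sup>\<star>" b]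
      by (simp add: Cons monomial_def adj_mult mult.assoc)
    also have "\<dots> = complex_of_real (if a = b then p b else 0) *\<^sub>C monomial \<mu> \<nu>'"
      by (auto simp: orthogonal' monomial_def scaleR_scaleC)
    finally show ?thesis
      using ergodic_limit_scaleC[OF c] ergodic_limit_\<phi> by metis
  qed
qed

text \<open>Convergence passes from the dense span by an e/3 argument: the iterates are uniformly
  contractive, and the limit scalars of a Cauchy sequence are again Cauchy because
  \<open>ergodic_limit_norm_le\<close> bounds their differences.\<close>

lemma ergodic_limit_ex: "\<exists>c. ergodic_limit x c"
proof -
  let ?M = "complex_vector.span monomials"
  have ex: "\<exists>c. ergodic_limit y c" if "y \<in> ?M" for y
    using that
  proof (induction rule: complex_vector.span_induct_alt)
    case base
    show ?case using ergodic_limit_diff[OF ergodic_limit_one ergodic_limit_one] by auto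
  next
    case (step c x y)
    then obtain b d where "ergodic_limit x b" "ergodic_limit y d"
      using ergodic_limit_monomial by (auto simp only: mem_Collect_eq) blast
    then show ?case by (blast intro: ergodic_limit_add ergodic_limit_scaleC)
  qed
  have "\<exists>y\<in>?M. dist y x < inverse (Suc n)" for n
    using span_monomials_dense by (intro closure_approachable[THEN iffD1, rule_format]) auto
  then obtain y where y: "\<And>n. y n \<in> ?M" "\<And>n. norm (y n - x) < inverse (Suc n)"
    unfolding dist_norm by metis
  have "\<forall>n. \<exists>c. ergodic_limit (y n) c" using ex y(1) by blast
  then obtain c where c: "\<And>n. ergodic_limit (y n) (c n)" by metis
  have inv: "(\<lambda>n. inverse (real (Suc n))) \<longlonglongrightarrow> 0" by (rule LIMSEQ_inverse_real_of_nat)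
  have ylim: "(\<lambda>n. y n - x) \<longlonglongrightarrow> 0"
    by (rule Lim_null_comparison[OF _ inv]) (use y(2) in \<open>auto intro!: always_eventually less_imp_le\<close>)
  then have "y \<longlonglongrightarrow> x" by (simp add: LIM_zero_iff)
  then have "Cauchy y" by (rule LIMSEQ_imp_Cauchy)
  have "Cauchy c"
  proof (rule metric_CauchyI)
    fix e :: real assume "e > 0"
    with \<open>Cauchy y\<close> obtain N where "\<forall>m\<ge>N. \<forall>n\<ge>N. dist (y m) (y n) < e" by (meson metric_CauchyD)
    moreover have "dist (c m) (c n) \<le> dist (y m) (y n)" for m n
      unfolding dist_norm by (rule ergodic_limit_norm_le[OF ergodic_limit_diff[OF c c]])
    ultimately show "\<exists>N. \<forall>m\<ge>N. \<forall>n\<ge>N. dist (c m) (c n) < e" by (meson le_less_trans)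
  qed
  then obtain b where b: "c \<longlonglongrightarrow> b" using Cauchy_convergent convergent_def by blast
  have "(\<lambda>n. (\<phi> ^^ n) x) \<longlonglongrightarrow> b *\<^sub>C 1"
  proof (rule metric_LIMSEQ_I)
    fix e :: real assume e: "e > 0"
    from b e have "eventually (\<lambda>k. dist (c k) b < e / 3) sequentially"
      by (intro tendstoD) auto
    moreover from \<open>y \<longlonglongrightarrow> x\<close> e have "eventually (\<lambda>k. dist (y k) x < e / 3) sequentially"
      by (intro tendstoD) auto
    ultimately have "eventually (\<lambda>k. dist (c k) b < e / 3 \<and> dist (y k) x < e / 3) sequentially"
      by (rule eventually_conj)
    then obtain k where k: "norm (c k - b) < e / 3" "norm (y k - x) < e / 3"
      unfolding dist_norm eventually_sequentially by blast
    obtain N where N: "\<And>n. n \<ge> N \<Longrightarrow> norm ((\<phi> ^^ n) (y k) - c k *\<^sub>C 1) < e / 3"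
      using c[of k, unfolded ergodic_limit_def, THEN metric_LIMSEQ_D, of "e / 3"] e
      unfolding dist_norm by auto
    have "norm ((\<phi> ^^ n) x - b *\<^sub>C 1) < e" if n: "n \<ge> N" for n
    proof -
      have lt: "norm ((\<phi> ^^ n) (y k - x)) < e / 3" "norm ((c k - b) *\<^sub>C (1::'a)) < e / 3"
        using le_less_trans[OF norm_\<phi>_pow k(2)] k(1) by simp_all
      have eq: "(\<phi> ^^ n) x - b *\<^sub>C 1 = ((\<phi> ^^ n) (y k) - c k *\<^sub>C 1) - (\<phi> ^^ n) (y k - x)
          + (c k - b) *\<^sub>C 1"
        by (simp add: \<phi>_pow_diff complex_vector.scale_left_diff_distrib)
      have "norm ((\<phi> ^^ n) x - b *\<^sub>C 1)
          \<le> norm ((\<phi> ^^ n) (y k) - c k *\<^sub>C 1) + norm ((\<phi> ^^ n) (y k - x)) + norm ((c k - b) *\<^sub>C (1::'a))"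
        unfolding eq by (rule order_trans[OF norm_triangle_ineq add_right_mono[OF norm_triangle_ineq4]])
      with N[OF n] lt show ?thesis by linarith
    qed
    then show "\<exists>N. \<forall>n\<ge>N. dist ((\<phi> ^^ n) x) (b *\<^sub>C 1) < e" unfolding dist_norm by blast
  qed
  then show ?thesis by (auto simp: ergodic_limit_def)
qed

section \<open>The limit state and its positivity\<close>

definition \<omega> :: "'a \<Rightarrow> complex" where "\<omega> x = (THE c. ergodic_limit x c)"

lemma ergodic_limit_iff: "ergodic_limit x c \<longleftrightarrow> \<omega> x = c"
proof -
  obtain b where b: "ergodic_limit x b" using ergodic_limit_ex by blast
  have "\<omega> x = b"
    unfolding \<omega>_def using b by (rule the_equality) (rule ergodic_limit_unique[OF _ b])
  with b show ?thesis using ergodic_limit_unique[of x b c] by auto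
qed

lemma ergodic_limit_\<omega>: "ergodic_limit x (\<omega> x)"
  by (simp add: ergodic_limit_iff)

lemma \<omega>_add: "\<omega> (x + y) = \<omega> x + \<omega> y"
  by (rule ergodic_limit_add[OF ergodic_limit_\<omega> ergodic_limit_\<omega>, unfolded ergodic_limit_iff])

lemma \<omega>_scaleC: "\<omega> (c *\<^sub>C x) = c * \<omega> x"
  by (rule ergodic_limit_scaleC[OF ergodic_limit_\<omega>, unfolded ergodic_limit_iff])

lemma \<omega>_one: "\<omega> 1 = 1"
  by (rule ergodic_limit_one[unfolded ergodic_limit_iff])

lemma \<omega>_\<phi>: "\<omega> (\<phi> x) = \<omega> x"
  by (rule ergodic_limit_\<phi>[of x "\<omega> x", unfolded ergodic_limit_iff, THEN iffD2, OF refl])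

lemma \<omega>_adj: "\<omega> (x\<^sup>\<star>) = cnj (\<omega> x)"
  by (rule ergodic_limit_adj[OF ergodic_limit_\<omega>, unfolded ergodic_limit_iff])

lemma norm_\<omega>: "cmod (\<omega> x) \<le> norm x"
  by (rule ergodic_limit_norm_le[OF ergodic_limit_\<omega>])

lemma bounded_linear_\<omega>: "bounded_linear \<omega>"
  by (rule bounded_linear_intro[where K = 1])
    (simp_all add: \<omega>_add scaleR_scaleC \<omega>_scaleC norm_\<omega> scaleR_conv_of_real[where 'a = complex])

lemma \<omega>_zero: "\<omega> 0 = 0"
proof -
  have "\<omega> 0 = \<omega> 0 + \<omega> 0" using \<omega>_add[of 0 0] by (simp only: add_0_left)
  then show ?thesis by simp
qed

lemma \<omega>_sum: "\<omega> (sum f A) = (\<Sum>i\<in>A. \<omega> (f i))"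
  using linear_sum[OF bounded_linear.linear[OF bounded_linear_\<omega>]] .

lemma \<omega>_gen_mult: "\<omega> (s j * x) = p j * \<omega> (x * s j)"
  using \<omega>_\<phi>[of "s j * x"] by (simp add: \<phi>_gen_mult scaleR_scaleC \<omega>_scaleC)

lemma \<omega>_mult_adj_gen: "\<omega> (x * (s j)\<^sup>\<star>) = p j * \<omega> ((s j)\<^sup>\<star> * x)"
  using \<omega>_\<phi>[of "x * (s j)\<^sup>\<star>"] by (simp add: \<phi>_mult_adj_gen scaleR_scaleC \<omega>_scaleC)

lemma \<omega>_gen_word_orthonormal:
  "\<omega> ((gen_word \<mu>)\<^sup>\<star> * gen_word \<nu>) = (if \<mu> = \<nu> then 1 else 0)"
proof -
  have word: "\<omega> (gen_word \<kappa>) = (if \<kappa> = [] then 1 else 0)" for \<kappa>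
    using ergodic_limit_gen_word[of \<kappa>] by (simp add: ergodic_limit_iff \<omega>_one)
  show ?thesis
  proof (cases rule: gen_word_adj_mult_cases[where \<mu> = \<mu> and \<nu> = \<nu>])
    case (1 \<kappa>)
    show ?thesis unfolding 1(2) word using 1(1) by simp
  next
    case (2 \<kappa>)
    show ?thesis unfolding 2(2) \<omega>_adj word using 2(1) by simp
  next
    case 3
    show ?thesis unfolding 3(1) \<omega>_zero using 3(2) by simp
  qed
qed

text \<open>Invariance under \<open>\<phi>\<close> reduces positivity at \<open>y\<close> to positivity at every \<open>y * s j\<close>. After
  enough such steps all adjoint generators have cancelled, and on polynomials in the generators
  positivity is orthonormality of the words.\<close>

abbreviation gen_polynomials :: "'a set" where
  "gen_polynomials \<equiv> complex_vector.span (range gen_word)"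

lemma \<omega>_pos_gen_polynomials:
  assumes "y \<in> gen_polynomials" shows "\<omega> (y\<^sup>\<star> * y) \<in> \<real>\<^sub>\<ge>\<^sub>0"
proof -
  obtain A c where A: "finite A" "A \<subseteq> range gen_word" "y = (\<Sum>a\<in>A. c a *\<^sub>C a)"
    using assms unfolding complex_vector.span_explicit by blast
  \<comment> \<open>The span is indexed by elements of the algebra, orthonormality by words; one
    word is chosen for each element.\<close>
  obtain W where W: "inj_on gen_word W" "A = gen_word ` W"
    using A(2) by (metis subset_image_inj)
  then have finW: "finite W" using A(1) finite_image_iff by blast
  from W have y: "y = (\<Sum>\<mu>\<in>W. c (gen_word \<mu>) *\<^sub>C gen_word \<mu>)"
    using A(3) by (simp add: sum.reindex)
  have "\<omega> (y\<^sup>\<star> * y) = (\<Sum>\<mu>\<in>W. \<Sum>\<nu>\<in>W. cnj (c (gen_word \<mu>)) * c (gen_word \<nu>) *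
      \<omega> ((gen_word \<mu>)\<^sup>\<star> * gen_word \<nu>))"
    by (simp add: y adj_sum adj_scaleC sum_product \<omega>_sum \<omega>_scaleC mult_scaleC_left mult_scaleC_right
        mult.assoc scaleC_scaleC mult.left_commute)
  also have "\<dots> = (\<Sum>\<mu>\<in>W. of_real ((cmod (c (gen_word \<mu>)))\<^sup>2))"
  proof (rule sum.cong[OF refl])
    fix \<mu> assume \<mu>: "\<mu> \<in> W"
    have "(\<Sum>\<nu>\<in>W. cnj (c (gen_word \<mu>)) * c (gen_word \<nu>) * \<omega> ((gen_word \<mu>)\<^sup>\<star> * gen_word \<nu>))
        = (\<Sum>\<nu>\<in>W. if \<nu> = \<mu> then cnj (c (gen_word \<mu>)) * c (gen_word \<mu>) else 0)"
      by (rule sum.cong) (auto simp: \<omega>_gen_word_orthonormal)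
    also have "\<dots> = c (gen_word \<mu>) * cnj (c (gen_word \<mu>))"
      using finW \<mu> by (simp only: sum.delta if_True mult.commute)
    finally show "(\<Sum>\<nu>\<in>W. cnj (c (gen_word \<mu>)) * c (gen_word \<nu>) * \<omega> ((gen_word \<mu>)\<^sup>\<star> * gen_word \<nu>))
        = of_real ((cmod (c (gen_word \<mu>)))\<^sup>2)"
      by (simp only: complex_norm_square)
  qed
  also have "\<dots> = of_real (\<Sum>\<mu>\<in>W. (cmod (c (gen_word \<mu>)))\<^sup>2)" by simp
  also have "\<dots> \<in> \<real>\<^sub>\<ge>\<^sub>0" by (simp only: nonneg_Reals_of_real_iff) (simp add: sum_nonneg)
  finally show ?thesis .
qed

lemma \<omega>_pos_step:
  assumes "\<And>j. \<omega> ((y * s j)\<^sup>\<star> * (y * s j)) \<in> \<real>\<^sub>\<ge>\<^sub>0"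
  shows "\<omega> (y\<^sup>\<star> * y) \<in> \<real>\<^sub>\<ge>\<^sub>0"
proof -
  have "\<omega> (y\<^sup>\<star> * y) = (\<Sum>j\<in>UNIV. of_real (p j) * \<omega> ((y * s j)\<^sup>\<star> * (y * s j)))"
    using \<omega>_\<phi>[of "y\<^sup>\<star> * y"]
    by (simp add: \<phi>_def \<omega>_sum scaleR_scaleC \<omega>_scaleC adj_mult mult.assoc)
  also have "\<dots> \<in> \<real>\<^sub>\<ge>\<^sub>0"
    using assms p_pos
    by (intro sum_nonneg_Reals nonneg_Reals_mult_I) (auto simp: less_imp_le)
  finally show ?thesis .
qed

lemma \<omega>_pos_words:
  assumes "\<And>\<nu>::'d list. length \<nu> = n \<Longrightarrow> y * gen_word \<nu> \<in> gen_polynomials"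
  shows "\<omega> (y\<^sup>\<star> * y) \<in> \<real>\<^sub>\<ge>\<^sub>0"
  using assms
proof (induction n arbitrary: y)
  case 0
  then show ?case using \<omega>_pos_gen_polynomials[of y] by auto
next
  case (Suc n)
  show ?case
  proof (rule \<omega>_pos_step, rule Suc.IH)
    fix j and \<nu> :: "'d list" assume "length \<nu> = n"
    then show "y * s j * gen_word \<nu> \<in> gen_polynomials"
      using Suc.prems[of "j # \<nu>"] by (simp add: mult.assoc)
  qed
qed

lemma monomial_mult_gen_word:
  assumes "length \<nu> \<le> length \<kappa>"
  shows "monomial \<mu> \<nu> * gen_word \<kappa> \<in> gen_polynomials"
proof -
  have *: "gen_word \<kappa> \<in> gen_polynomials" for \<kappa> by (simp add: complex_vector.span_base)
  have eq: "monomial \<mu> \<nu> * gen_word \<kappa> = gen_word \<mu> * ((gen_word \<nu>)\<^sup>\<star> * gen_word \<kappa>)"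
    by (simp add: monomial_def mult.assoc)
  show ?thesis
  proof (cases rule: gen_word_adj_mult_cases[where \<mu> = \<nu> and \<nu> = \<kappa>])
    case (1 \<iota>)
    then show ?thesis using *[of "\<mu> @ \<iota>"] unfolding eq 1(2) by simp
  next
    case (2 \<iota>)
    then have "\<iota> = []" using assms by simp
    then show ?thesis unfolding eq 2(2) using *[of \<mu>] by simp
  next
    case 3
    show ?thesis unfolding eq 3(1) by (simp add: complex_vector.span_zero)
  qed
qed

lemma \<omega>_pos: "\<omega> (x\<^sup>\<star> * x) \<in> \<real>\<^sub>\<ge>\<^sub>0"
proof -
  let ?M = "complex_vector.span monomials"
  \<comment> \<open>Here \<open>n\<close> bounds the lengths of the adjoint words occurring in
    \<open>y\<close>; a word at least that long on the right cancels all of them.\<close>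
  have "\<exists>n. \<forall>\<kappa>. n \<le> length \<kappa> \<longrightarrow> y * gen_word \<kappa> \<in> gen_polynomials" if "y \<in> ?M" for y
    using that
  proof (induction rule: complex_vector.span_induct_alt)
    case base
    show ?case by (simp add: complex_vector.span_zero)
  next
    case (step c x y)
    then obtain n \<mu> \<nu> where x: "x = monomial \<mu> \<nu>"
      and n: "\<And>\<kappa>. n \<le> length \<kappa> \<Longrightarrow> y * gen_word \<kappa> \<in> gen_polynomials" by auto
    have "(c *\<^sub>C x + y) * gen_word \<kappa> \<in> gen_polynomials" if "max n (length \<nu>) \<le> length \<kappa>" for \<kappa>
      using that n[of \<kappa>] monomial_mult_gen_word[of \<nu> \<kappa> \<mu>]
      by (simp add: x distrib_right mult_scaleC_left complex_vector.span_add complex_vector.span_scale)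
    then show ?case by blast
  qed
  then have "?M \<subseteq> {y. \<omega> (y\<^sup>\<star> * y) \<in> \<real>\<^sub>\<ge>\<^sub>0}" using \<omega>_pos_words by (metis (mono_tags, lifting) le_refl mem_Collect_eq subsetI)
  moreover have "closed {y. \<omega> (y\<^sup>\<star> * y) \<in> \<real>\<^sub>\<ge>\<^sub>0}"
  proof -
    have "continuous_on UNIV (\<lambda>y. \<omega> (y\<^sup>\<star> * y))"
      by (intro bounded_linear.continuous_on[OF bounded_linear_\<omega>] continuous_intros)
    from closed_vimage[OF closed_nonneg_Reals_complex this]
    show ?thesis by (simp add: vimage_def)
  qed
  ultimately have "closure ?M \<subseteq> {y. \<omega> (y\<^sup>\<star> * y) \<in> \<real>\<^sub>\<ge>\<^sub>0}" by (rule closure_minimal)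
  then show ?thesis using span_monomials_dense by auto
qed

lemma state_\<omega>: "state \<omega>"
  by (simp add: state_def \<omega>_add \<omega>_scaleC \<omega>_pos \<omega>_one)

end

subsection \<open>The fixed-point algebra\<close>

definition word_weight :: "('d \<Rightarrow> int) \<Rightarrow> 'd list \<Rightarrow> int" where
  "word_weight L \<mu> = sum_list (map L \<mu>)"

lemma word_weight_simps [simp]:
  "word_weight L [] = 0"
  "word_weight L (j # \<mu>) = L j + word_weight L \<mu>"
  "word_weight L (\<mu> @ \<nu>) = word_weight L \<mu> + word_weight L \<nu>"
  by (simp_all add: word_weight_def)

fun letter_weight :: "('d \<Rightarrow> int) \<Rightarrow> 'd letter \<Rightarrow> int" where
  "letter_weight L (Gen j) = L j"
| "letter_weight L (Adj j) = - L j"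

lemma span_mult_closed:
  fixes S :: "'a::unital_cstar_algebra set"
  assumes S: "\<And>x y. x \<in> S \<Longrightarrow> y \<in> S \<Longrightarrow> x * y \<in> complex_vector.span S"
    and x: "x \<in> complex_vector.span S" and y: "y \<in> complex_vector.span S"
  shows "x * y \<in> complex_vector.span S"
  using x
proof (induction rule: complex_vector.span_induct_alt)
  case (step c u v)
  from y have "u * y \<in> complex_vector.span S"
  proof (induction rule: complex_vector.span_induct_alt)
    case (step b w z)
    then show ?case using S[OF \<open>u \<in> S\<close>, of w]
      by (simp add: distrib_left mult_scaleC_right complex_vector.span_add complex_vector.span_scale)
  qed (simp add: complex_vector.span_zero)
  then show ?case using step
    by (simp add: distrib_right mult_scaleC_left complex_vector.span_add complex_vector.span_scale)
qed (simp add: complex_vector.span_zero)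

lemma span_adj_closed:
  fixes S :: "'a::unital_cstar_algebra set"
  assumes S: "\<And>x. x \<in> S \<Longrightarrow> x\<^sup>\<star> \<in> complex_vector.span S" and x: "x \<in> complex_vector.span S"
  shows "x\<^sup>\<star> \<in> complex_vector.span S"
  using x
proof (induction rule: complex_vector.span_induct_alt)
  case (step c u v)
  then show ?case using S[of u]
    by (simp add: adj_add adj_scaleC complex_vector.span_add complex_vector.span_scale)
qed (simp add: complex_vector.span_zero)

locale cuntz_dynamics = cuntz_family s for s :: "'d::finite \<Rightarrow> 'a::unital_cstar_algebra" +
  fixes L :: "'d \<Rightarrow> int" and \<sigma> :: "real \<Rightarrow> 'a \<Rightarrow> 'a"
  assumes flow: "cuntz_flow s L \<sigma>"
begin

lemma hom: "unital_star_hom (\<sigma> t)"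
  using flow by (auto simp: cuntz_flow_def one_parameter_group_def intro: unital_star_hom_automorphism)

lemma \<sigma>_simps:
  "\<sigma> t (x + y) = \<sigma> t x + \<sigma> t y" "\<sigma> t (c *\<^sub>C x) = c *\<^sub>C \<sigma> t x"
  "\<sigma> t (x * y) = \<sigma> t x * \<sigma> t y" "\<sigma> t (x\<^sup>\<star>) = (\<sigma> t x)\<^sup>\<star>" "\<sigma> t 1 = 1"
  using hom[of t] by (auto simp: unital_star_hom_def star_hom_def)

lemma \<sigma>_diff: "\<sigma> t (x - y) = \<sigma> t x - \<sigma> t y"
  using \<sigma>_simps(1)[of t "x - y" y] by (simp add: algebra_simps)

lemma \<sigma>_gen: "\<sigma> t (s j) = cis (t * L j) *\<^sub>C s j"
  using flow by (simp add: cuntz_flow_def)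

lemma \<sigma>_plus: "\<sigma> (t + u) x = \<sigma> t (\<sigma> u x)"
  using flow by (simp add: cuntz_flow_def one_parameter_group_def)

lemma norm_\<sigma>: "norm (\<sigma> t x) \<le> norm x"
  by (rule unital_star_hom_contractive[OF hom])

lemma bounded_linear_\<sigma>: "bounded_linear (\<sigma> t)"
  by (rule bounded_linear_intro[where K = 1]) (simp_all add: \<sigma>_simps scaleR_scaleC norm_\<sigma>)

text \<open>Integrality of the weights enters here: at time \<open>2 * pi\<close> every generator is
  fixed, and a continuous unital *-homomorphism is determined on the generators.\<close>

lemma \<sigma>_period: "\<sigma> (t + 2 * pi) x = \<sigma> t x"
proof -
  have "cis (2 * pi * of_int k) = 1" for k by (rule cis_multiple_2pi) simp
  then have "\<sigma> (2 * pi) (s j) = s j" for j by (simp add: \<sigma>_gen)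
  then have "\<sigma> (2 * pi) = id"
    by (intro cuntz_algebra_hom_unique[OF cuntz hom])
      (auto simp: unital_star_hom_def star_hom_def intro: bounded_linear.continuous_on[OF bounded_linear_\<sigma>] continuous_on_id)
  then show ?thesis by (simp add: \<sigma>_plus)
qed

lemma \<sigma>_gen_word: "\<sigma> t (gen_word \<mu>) = cis (t * word_weight L \<mu>) *\<^sub>C gen_word \<mu>"
  by (induction \<mu>)
    (simp_all add: \<sigma>_simps \<sigma>_gen mult_scaleC_left mult_scaleC_right scaleC_scaleC cis_mult distrib_left
      add.commute)

lemma \<sigma>_monomial:
  "\<sigma> t (monomial \<mu> \<nu>) = cis (t * of_int (word_weight L \<mu> - word_weight L \<nu>)) *\<^sub>C monomial \<mu> \<nu>"
  by (simp add: monomial_def \<sigma>_simps \<sigma>_gen_word adj_scaleC mult_scaleC_left mult_scaleC_right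
      scaleC_scaleC cis_cnj cis_mult right_diff_distrib)

lemma closed_fixed_point_algebra: "closed (fixed_point_algebra \<sigma>)"
proof -
  have "closed {x. \<sigma> t x = x}" for t
    by (intro closed_Collect_eq bounded_linear.continuous_on[OF bounded_linear_\<sigma>] continuous_intros)
  then have "closed (\<Inter>t. {x. \<sigma> t x = x})" by blast
  also have "(\<Inter>t. {x. \<sigma> t x = x}) = fixed_point_algebra \<sigma>"
    by (auto simp: fixed_point_algebra_def)
  finally show ?thesis .
qed

text \<open>The step \<open>k\<close> annihilates the spectral subspaces of weights \<open>\<plusminus>k\<close> because
  \<open>cis (\<plusminus>pi) = -1\<close>, so finitely many steps project a sum of monomials onto its invariant part.\<close>

primrec half_average :: "nat \<Rightarrow> 'a \<Rightarrow> 'a" where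
  "half_average 0 x = x"
| "half_average (Suc k) x =
    (1/2) *\<^sub>C (half_average k x + \<sigma> (pi / real (Suc k)) (half_average k x))"

lemma half_average_add: "half_average k (x + y) = half_average k x + half_average k y"
  by (induction k) (simp_all add: \<sigma>_simps scaleC_add_right)

lemma half_average_scaleC: "half_average k (c *\<^sub>C x) = c *\<^sub>C half_average k x"
  by (induction k) (simp_all add: \<sigma>_simps scaleC_add_right scaleC_scaleC mult.commute)

lemma norm_half_average: "norm (half_average k x) \<le> norm x"
proof (induction k)
  case (Suc k)
  have "norm (half_average (Suc k) x)
      \<le> 1/2 * (norm (half_average k x) + norm (\<sigma> (pi / real (Suc k)) (half_average k x)))"
    using norm_triangle_ineq[of "half_average k x" "\<sigma> (pi / real (Suc k)) (half_average k x)"] by simp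
  also have "\<dots> \<le> norm (half_average k x)"
    using norm_\<sigma>[of "pi / real (Suc k)" "half_average k x"] by simp
  finally show ?case using Suc.IH by simp
qed simp

lemma half_average_fixed:
  assumes "x \<in> fixed_point_algebra \<sigma>" shows "half_average k x = x"
proof (induction k)
  case (Suc k)
  have "half_average (Suc k) x = (1/2) *\<^sub>C (x + x)"
    using assms by (simp add: Suc fixed_point_algebra_def)
  also have "\<dots> = (1/2 + 1/2) *\<^sub>C x" by (simp only: scaleC_add_left scaleC_add_right)
  finally show ?case by simp
qed simp

text \<open>Every step multiplies \<open>m\<close> by a scalar. The step of index \<bar>w\<bar>
  contributes (1 + cis (\<plusminus>pi))/2 = 0, and a zero coefficient stays zero
  afterwards.\<close>

lemma half_average_eigenvector:
  assumes w: "w \<noteq> 0" and \<sigma>m: "\<And>t. \<sigma> t m = cis (t * of_int w) *\<^sub>C m"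
  shows "nat \<bar>w\<bar> \<le> k \<Longrightarrow> half_average k m = 0"
proof -
  have "\<exists>c. half_average k m = c *\<^sub>C m \<and> (nat \<bar>w\<bar> \<le> k \<longrightarrow> c = 0)" for k
  proof (induction k)
    case 0
    show ?case using w by (intro exI[of _ 1]) auto
  next
    case (Suc k)
    then obtain c where c: "half_average k m = c *\<^sub>C m" "nat \<bar>w\<bar> \<le> k \<Longrightarrow> c = 0" by blast
    define u where "u = cis (pi / real (Suc k) * of_int w)"
    have eq: "half_average (Suc k) m = ((1/2) * (c + c * u)) *\<^sub>C m"
      by (simp only: half_average.simps c \<sigma>_simps \<sigma>m u_def scaleC_scaleC flip: scaleC_add_left)
    have "c + c * u = 0" if le: "nat \<bar>w\<bar> \<le> Suc k"
    proof (cases "nat \<bar>w\<bar> \<le> k")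
      case False
      with le have "\<bar>w\<bar> = int (Suc k)" by linarith
      then have "w = int (Suc k) \<or> w = - int (Suc k)" by linarith
      then have "u = cis pi \<or> u = cis (- pi)"
      proof
        assume "w = int (Suc k)"
        then have "pi / real (Suc k) * of_int w = pi" by simp
        then show ?thesis unfolding u_def by presburger
      next
        assume "w = - int (Suc k)"
        then have "real_of_int w = - real (Suc k)" by linarith
        then have "pi / real (Suc k) * of_int w = - pi" by (simp only: mult_minus_right) simp
        then show ?thesis unfolding u_def by presburger
      qed
      then have "u = -1" by (auto simp: cis_cnj[symmetric])
      then show ?thesis by simp
    qed (simp add: c)
    then show ?case using eq by (intro exI[of _ "(1/2) * (c + c * u)"]) simp
  qed
  then show "nat \<bar>w\<bar> \<le> k \<Longrightarrow> half_average k m = 0" by fastforce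
qed

section \<open>Approximation of fixed points by balanced monomials\<close>

abbreviation balanced_monomials :: "'a set" where
  "balanced_monomials \<equiv> {monomial \<mu> \<nu> |\<mu> \<nu>. word_weight L \<mu> = word_weight L \<nu>}"

lemma balanced_fixed: "complex_vector.span balanced_monomials \<subseteq> fixed_point_algebra \<sigma>"
proof
  fix x assume "x \<in> complex_vector.span balanced_monomials"
  then show "x \<in> fixed_point_algebra \<sigma>"
  proof (induction rule: complex_vector.span_induct_alt)
    case base
    show ?case using \<sigma>_diff[of _ 1 1] by (simp add: fixed_point_algebra_def)
  next
    case (step c x y)
    then show ?case by (auto simp: fixed_point_algebra_def \<sigma>_simps \<sigma>_monomial)
  qed
qed

text \<open>\<open>half_average n\<close> stands in for the conditional expectation given by the
  mean of the flow over a period: it is contractive, is the identity on fixed points, and for large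
  \<open>n\<close> maps a given combination of monomials into the balanced span. How large depends
  on the combination, so each approximant is projected with an \<open>n\<close> of its own.\<close>

lemma fixed_point_algebra_eq_closure:
  "fixed_point_algebra \<sigma> = closure (complex_vector.span balanced_monomials)"
proof
  show "closure (complex_vector.span balanced_monomials) \<subseteq> fixed_point_algebra \<sigma>"
    using balanced_fixed closed_fixed_point_algebra by (rule closure_minimal)
  show "fixed_point_algebra \<sigma> \<subseteq> closure (complex_vector.span balanced_monomials)"
  proof
    fix x assume x: "x \<in> fixed_point_algebra \<sigma>"
    have ex: "\<exists>N. \<forall>n\<ge>N. half_average n y \<in> complex_vector.span balanced_monomials"
      if "y \<in> complex_vector.span monomials" for y
      using that
    proof (induction rule: complex_vector.span_induct_alt)
      case base
      show ?case using half_average_scaleC[of _ 0 0] by (simp add: complex_vector.span_zero)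
    next
      case (step c m y)
      from step(1) obtain \<mu> \<nu> where m: "m = monomial \<mu> \<nu>" by (elim CollectE exE conjE)
      from step(2) obtain N where
        N: "\<forall>n\<ge>N. half_average n y \<in> complex_vector.span balanced_monomials" by (elim exE)
      define w where "w = word_weight L \<mu> - word_weight L \<nu>"
      have "half_average n m \<in> complex_vector.span balanced_monomials" if n: "n \<ge> nat \<bar>w\<bar>" for n
      proof (cases "w = 0")
        case True
        then have m': "m \<in> complex_vector.span balanced_monomials"
          unfolding m w_def by (intro complex_vector.span_base) auto
        then show ?thesis using half_average_fixed[OF subsetD[OF balanced_fixed m']] by simp
      next
        case False
        have "half_average n m = 0"
          by (rule half_average_eigenvector[OF False _ n]) (simp only: m \<sigma>_monomial w_def)
        then show ?thesis by (simp add: complex_vector.span_zero)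
      qed
      with N have "half_average n (c *\<^sub>C m + y) \<in> complex_vector.span balanced_monomials"
        if "n \<ge> max N (nat \<bar>w\<bar>)" for n
        using that by (simp add: half_average_add half_average_scaleC
            complex_vector.span_add complex_vector.span_scale)
      then show ?case by blast
    qed
    show "x \<in> closure (complex_vector.span balanced_monomials)"
      unfolding closure_approachable
    proof (intro allI impI)
      fix e :: real assume e: "e > 0"
      have "x \<in> closure (complex_vector.span monomials)" by (simp only: span_monomials_dense UNIV_I)
      then obtain y where y: "y \<in> complex_vector.span monomials" "dist y x < e"
        unfolding closure_approachable using e by blast
      obtain n where n: "half_average n y \<in> complex_vector.span balanced_monomials"
        using ex[OF y(1)] by blast
      have "half_average n (y - x) = half_average n y - x"
        using half_average_add[of n y "(-1) *\<^sub>C x"] half_average_fixed[OF x, of n]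
        by (simp only: half_average_scaleC) simp
      then have "dist (half_average n y) x \<le> dist y x"
        using norm_half_average[of n "y - x"] by (simp add: dist_norm)
      with n y(2) show "\<exists>z\<in>complex_vector.span balanced_monomials. dist z x < e"
        by (meson le_less_trans)
    qed
  qed
qed

lemma AF_fixed_point_algebra:
  assumes pos: "\<And>j. L j > 0"
  shows "AF_algebra (fixed_point_algebra \<sigma>)"
proof -
  define B where "B n = {monomial \<mu> \<nu> |\<mu> \<nu>. word_weight L \<mu> = word_weight L \<nu> \<and> word_weight L \<mu> \<le> int n}" for n
  have nonneg: "word_weight L \<mu> \<ge> 0" for \<mu>
    using pos by (induction \<mu>) (auto simp: add_nonneg_nonneg less_imp_le)
  \<comment> \<open>Each letter weighs at least 1, so a bound on the weight bounds the length and
    leaves finitely many words.\<close>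
  have len: "int (length \<mu>) \<le> word_weight L \<mu>" for \<mu>
  proof (induction \<mu>)
    case (Cons j \<mu>)
    then show ?case using pos[of j] by simp
  qed simp
  have "finite (B n)" for n
  proof -
    have "B n \<subseteq> (\<lambda>(\<mu>, \<nu>). monomial \<mu> \<nu>) ` ({\<mu>. length \<mu> \<le> n} \<times> {\<mu>. length \<mu> \<le> n})"
    proof
      fix x assume "x \<in> B n"
      then obtain \<mu> \<nu> where x: "x = monomial \<mu> \<nu>" "word_weight L \<mu> = word_weight L \<nu>" "word_weight L \<mu> \<le> int n"
        by (auto simp: B_def)
      have "length \<mu> \<le> n" "length \<nu> \<le> n" using len[of \<mu>] len[of \<nu>] x(2,3) by linarith+
      then show "x \<in> (\<lambda>(\<mu>, \<nu>). monomial \<mu> \<nu>) ` ({\<mu>. length \<mu> \<le> n} \<times> {\<mu>. length \<mu> \<le> n})"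
        by (intro image_eqI[of _ _ "(\<mu>, \<nu>)"]) (auto simp: x(1))
    qed
    moreover have "finite {\<mu> :: 'd list. length \<mu> \<le> n}"
      using finite_lists_length_le[of "UNIV :: 'd set" n] by simp
    ultimately show ?thesis by (meson finite_SigmaI finite_imageI finite_subset)
  qed
  then have fin: "finite_dimensional (complex_vector.span (B n))" for n
    by (auto simp: finite_dimensional_def)
  have mult: "x * y \<in> complex_vector.span (B n)" if x: "x \<in> B n" and y: "y \<in> B n" for x y n
  proof -
    obtain \<mu> \<nu> where x: "x = monomial \<mu> \<nu>" "word_weight L \<mu> = word_weight L \<nu>" "word_weight L \<mu> \<le> int n"
      using x by (auto simp: B_def)
    obtain \<kappa> \<rho> where y: "y = monomial \<kappa> \<rho>" "word_weight L \<kappa> = word_weight L \<rho>" "word_weight L \<kappa> \<le> int n"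
      using y by (auto simp: B_def)
    have xy: "x * y = gen_word \<mu> * ((gen_word \<nu>)\<^sup>\<star> * gen_word \<kappa>) * (gen_word \<rho>)\<^sup>\<star>"
      by (simp add: x y monomial_def mult.assoc)
    show ?thesis
    proof (cases rule: gen_word_adj_mult_cases[where \<mu> = \<nu> and \<nu> = \<kappa>])
      case (1 \<iota>)
      \<comment> \<open>As \<mu> and \<nu> have equal weight, \<mu> followed by \<iota> weighs as
        much as \<kappa>, so the bound \<open>n\<close> is not exceeded.\<close>
      have "x * y = monomial (\<mu> @ \<iota>) \<rho>" unfolding xy 1(2) by (simp add: monomial_def)
      moreover have "word_weight L (\<mu> @ \<iota>) = word_weight L \<rho>" "word_weight L (\<mu> @ \<iota>) \<le> int n"
        using x(2,3) y(2,3) arg_cong[OF 1(1), of "word_weight L"] by simp_all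
      ultimately have "x * y \<in> B n" unfolding B_def by blast
      then show ?thesis by (rule complex_vector.span_base)
    next
      case (2 \<iota>)
      have "x * y = monomial \<mu> (\<rho> @ \<iota>)" unfolding xy 2(2) by (simp add: monomial_def adj_mult mult.assoc)
      moreover have "word_weight L \<mu> = word_weight L (\<rho> @ \<iota>)"
        using x(2,3) y(2,3) arg_cong[OF 2(1), of "word_weight L"] by simp_all
      ultimately have "x * y \<in> B n" using x(3) unfolding B_def by blast
      then show ?thesis by (rule complex_vector.span_base)
    next
      case 3
      show ?thesis unfolding xy 3(1) by (simp add: complex_vector.span_zero)
    qed
  qed
  have adj: "x\<^sup>\<star> \<in> complex_vector.span (B n)" if "x \<in> B n" for x n
  proof (rule complex_vector.span_base)
    from that obtain \<mu> \<nu> where x: "x = monomial \<mu> \<nu>" "word_weight L \<mu> = word_weight L \<nu>" "word_weight L \<mu> \<le> int n"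
      by (auto simp: B_def)
    have "x\<^sup>\<star> = monomial \<nu> \<mu>" by (simp add: x monomial_def adj_mult adj_adj)
    then show "x\<^sup>\<star> \<in> B n" using x(2,3) unfolding B_def by (intro CollectI exI[of _ \<nu>] exI[of _ \<mu>]) simp
  qed
  have alg: "star_subalgebra (complex_vector.span (B n))" for n
    unfolding star_subalgebra_def
    using span_mult_closed[of "B n"] span_adj_closed[of "B n"] mult adj by blast
  have mono: "B m \<subseteq> B n" if "m \<le> n" for m n
  proof
    fix x assume "x \<in> B m"
    then obtain \<mu> \<nu> where x: "x = monomial \<mu> \<nu>" "word_weight L \<mu> = word_weight L \<nu>" "word_weight L \<mu> \<le> int m"
      by (auto simp: B_def)
    have "word_weight L \<mu> \<le> int n" using x(3) that by linarith
    then show "x \<in> B n" using x(1,2) unfolding B_def by blast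
  qed
  have "complex_vector.span balanced_monomials \<subseteq> (\<Union>n. complex_vector.span (B n))"
  proof
    fix x assume "x \<in> complex_vector.span balanced_monomials"
    then show "x \<in> (\<Union>n. complex_vector.span (B n))"
    proof (induction rule: complex_vector.span_induct_alt)
      case base
      show ?case by (auto intro: complex_vector.span_zero)
    next
      case (step c x y)
      then obtain \<mu> \<nu> where x: "x = monomial \<mu> \<nu>" "word_weight L \<mu> = word_weight L \<nu>" by blast
      obtain n where n: "y \<in> complex_vector.span (B n)" using step by blast
      define k where "k = max n (nat (word_weight L \<mu>))"
      have "word_weight L \<mu> \<le> int k" using nonneg[of \<mu>] by (simp add: k_def)
      then have "x \<in> B k" using x unfolding B_def by blast
      moreover have "y \<in> complex_vector.span (B k)"
        using n complex_vector.span_mono[OF mono[of n k]] by (auto simp: k_def)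
      ultimately have "c *\<^sub>C x + y \<in> complex_vector.span (B k)"
        by (simp add: complex_vector.span_add complex_vector.span_scale complex_vector.span_base)
      then show ?case by blast
    qed
  qed
  moreover have "complex_vector.span (B n) \<subseteq> complex_vector.span balanced_monomials" for n
    unfolding B_def by (intro complex_vector.span_mono) auto
  ultimately have "(\<Union>n. complex_vector.span (B n)) = complex_vector.span balanced_monomials" by blast
  then have "fixed_point_algebra \<sigma> = closure (\<Union>n. complex_vector.span (B n))"
    by (simp add: fixed_point_algebra_eq_closure)
  moreover have "complex_vector.span (B n) \<subseteq> complex_vector.span (B (Suc n))" for n
    by (intro complex_vector.span_mono mono) simp
  ultimately show ?thesis
    using alg fin unfolding AF_algebra_def by (intro exI[of _ "\<lambda>n. complex_vector.span (B n)"]) simp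
qed

lemma fixed_nonunitary_isometry:
  assumes "\<not> ((\<forall>j. L j > 0) \<or> (\<forall>j. L j < 0))"
  shows "\<exists>v\<in>fixed_point_algebra \<sigma>. v\<^sup>\<star> * v = 1 \<and> v * v\<^sup>\<star> \<noteq> 1"
proof -
  have iso: "(gen_word \<mu>)\<^sup>\<star> * gen_word \<mu> = 1" for \<mu>
    by (induction \<mu>) (simp_all add: adj_mult mult.assoc orthogonal')
  have nonunitary: "gen_word (j # \<mu>) * (gen_word (j # \<mu>))\<^sup>\<star> \<noteq> 1" for j \<mu>
  proof
    assume eq: "gen_word (j # \<mu>) * (gen_word (j # \<mu>))\<^sup>\<star> = 1"
    \<comment> \<open>A generator with another index is orthogonal to the range of the word; if that
      range projection were 1, \<open>s k\<close> would vanish.\<close>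
    obtain k where k: "k \<noteq> j" using ex_other_index by blast
    have "(s k)\<^sup>\<star> = (s k)\<^sup>\<star> * (gen_word (j # \<mu>) * (gen_word (j # \<mu>))\<^sup>\<star>)" by (simp only: eq mult_1_right)
    also have "\<dots> = 0" using k by (simp add: mult.assoc orthogonal')
    finally have "norm (s k) = 0" by (metis norm_adj norm_zero)
    then show False by (simp add: norm_gen)
  qed
  have "\<exists>j \<mu>. word_weight L (j # \<mu>) = 0"
  proof (cases "\<exists>j. L j = 0")
    case True
    then obtain j where "L j = 0" by blast
    then have "word_weight L [j] = 0" by simp
    then show ?thesis by blast
  next
    case False
    with assms obtain i j where ij: "L i > 0" "L j < 0" by (metis linorder_neqE_linordered_idom)
    have rep: "word_weight L (replicate n k) = int n * L k" for n k
      by (induction n) (simp_all add: distrib_right)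
    \<comment> \<open>Each of the two letters is repeated as often as the absolute weight of the
      other, so the contributions cancel.\<close>
    have "word_weight L (replicate (nat (- L j)) i @ replicate (nat (L i)) j) = 0"
      using ij by (simp add: rep)
    moreover have "replicate (nat (- L j)) i @ replicate (nat (L i)) j
        = i # (replicate (nat (- L j) - 1) i @ replicate (nat (L i)) j)"
      using ij by (cases "nat (- L j)") auto
    ultimately show ?thesis by metis
  qed
  then obtain j \<mu> where w: "word_weight L (j # \<mu>) = 0" by blast
  have "gen_word (j # \<mu>) \<in> fixed_point_algebra \<sigma>"
    unfolding fixed_point_algebra_def mem_Collect_eq \<sigma>_gen_word w by simp
  with iso nonunitary show ?thesis by blast
qed

end

subsection \<open>KMS states\<close>

text \<open>The identity theorem at the accumulation point 0. It extends periodicity and the group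
  law of the flow from real to complex time.\<close>

lemma entire_eq_on_reals:
  assumes f: "f holomorphic_on UNIV" and g: "g holomorphic_on UNIV"
    and eq: "\<And>t. f (complex_of_real t) = g (complex_of_real t)"
  shows "f z = g z"
proof -
  have lim: "(0::complex) islimpt \<real>"
    unfolding islimpt_approachable
  proof (intro allI impI)
    fix e :: real assume "e > 0"
    then show "\<exists>x'\<in>\<real>. x' \<noteq> (0::complex) \<and> dist x' 0 < e"
      by (intro bexI[of _ "complex_of_real (e / 2)"]) auto
  qed
  have "f z - g z = 0"
  proof (rule analytic_continuation[OF _ open_UNIV connected_UNIV _ _ lim, where f = "\<lambda>z. f z - g z"])
    show "(\<lambda>z. f z - g z) holomorphic_on UNIV" using f g by (intro holomorphic_intros)
    show "f z - g z = 0" if "z \<in> \<real>" for z using that eq by (auto elim: Reals_cases)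
  qed auto
  then show ?thesis by simp
qed

text \<open>The mean over a period along a horizontal line does not depend on the line; it is the
  increment of a primitive over one period, so no contour integral is needed.\<close>

lemma periodic_entire_means:
  fixes H :: "complex \<Rightarrow> complex"
  assumes H: "H holomorphic_on UNIV" and per: "\<And>z. H (z + 2 * of_real pi) = H z"
    and a: "\<And>t. cmod (H (u + complex_of_real t) - a) \<le> e"
    and b: "\<And>t. cmod (H (v + complex_of_real t) - b) \<le> d"
  shows "cmod (a - b) \<le> e + d"
proof -
  obtain P where P: "\<And>z. (P has_field_derivative H z) (at z)"
    using holomorphic_convex_primitive'[OF convex_UNIV open_UNIV H] by auto
  define Q where "Q z = P (z + 2 * of_real pi) - P z" for z :: complex
  have "(Q has_field_derivative 0) (at z)" for z
  proof -
    have "((\<lambda>z. P (z + 2 * of_real pi)) has_field_derivative H (z + 2 * of_real pi) * 1) (at z)"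
      by (rule DERIV_chain2[OF P]) (auto intro!: derivative_eq_intros)
    from DERIV_diff[OF this P[of z]] show ?thesis by (simp add: Q_def[abs_def] per)
  qed
  then obtain c where c: "\<And>z. Q z = c"
    using has_field_derivative_zero_constant[of UNIV Q] by auto
  \<comment> \<open>The mean over a period is \<open>c / (2 * pi)\<close>. The mean value inequality
    for \<open>P z - m * z\<close> along one period measures how far it is from
    \<open>m\<close>.\<close>
  have mean: "cmod (c - 2 * pi * m) \<le> r * (2 * pi)"
    if m: "\<And>t. cmod (H (w + complex_of_real t) - m) \<le> r" for w m :: complex and r :: real
  proof -
    let ?S = "closed_segment w (w + 2 * of_real pi)"
    have "cmod ((P w - m * w) - (P (w + 2 * of_real pi) - m * (w + 2 * of_real pi))) \<le> r * cmod (w - (w + 2 * of_real pi))"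
    proof (rule field_differentiable_bound[where S = ?S and f' = "\<lambda>z. H z - m"])
      fix z assume z: "z \<in> ?S"
      then obtain x where "z = (1 - x) *\<^sub>R w + x *\<^sub>R (w + 2 * of_real pi)"
        by (auto simp: closed_segment_def)
      then have "z = w + complex_of_real (x * (2 * pi))" by (simp add: algebra_simps scaleR_conv_of_real)
      then show "cmod (H z - m) \<le> r" using m by metis
      show "((\<lambda>z. P z - m * z) has_field_derivative H z - m) (at z within ?S)"
        by (rule has_field_derivative_at_within[OF DERIV_diff[OF P DERIV_cmult_Id]])
    qed auto
    moreover have "P w = P (w + 2 * of_real pi) - c" using c[of w] unfolding Q_def by (simp add: algebra_simps)
    moreover have "(P (w + 2 * of_real pi) - c - m * w) - (P (w + 2 * of_real pi) - m * (w + 2 * of_real pi))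
        = 2 * pi * m - c" by (simp add: algebra_simps)
    moreover have "cmod (w - (w + 2 * of_real pi)) = 2 * pi" by (simp add: norm_mult)
    ultimately have "cmod (2 * pi * m - c) \<le> r * (2 * pi)" by (simp only:)
    then show ?thesis by (simp add: norm_minus_commute)
  qed
  have "cmod (2 * pi * (a - b)) \<le> cmod (c - 2 * pi * b) + cmod (c - 2 * pi * a)"
    using norm_triangle_ineq4[of "c - 2 * pi * b" "c - 2 * pi * a"] by (simp add: algebra_simps)
  also have "\<dots> \<le> d * (2 * pi) + e * (2 * pi)" by (rule add_mono[OF mean[OF b] mean[OF a]])
  also have "cmod (2 * pi * (a - b)) = 2 * pi * cmod (a - b)" by (simp add: norm_mult)
  also have "d * (2 * pi) + e * (2 * pi) = 2 * pi * (e + d)" by (simp add: algebra_simps)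
  finally have "2 * pi * cmod (a - b) \<le> 2 * pi * (e + d)" .
  then show ?thesis by (rule mult_left_le_imp_le) simp
qed

text \<open>Intermediate values between 0, where the sum is the number of generators, and the
  logarithm of that number, where integrality makes every weight at least 1 and hence each term at
  most the reciprocal of the number.\<close>

lemma exp_weights_ex:
  fixes L :: "'d::finite \<Rightarrow> int"
  assumes "\<And>j. L j > 0"
  shows "\<exists>\<beta>. (\<Sum>j\<in>UNIV. exp (- \<beta> * real_of_int (L j))) = 1"
proof -
  define f where "f \<beta> = (\<Sum>j\<in>UNIV. exp (- \<beta> * real_of_int (L j)))" for \<beta>
  have n: "real (CARD('d)) \<ge> 1" using zero_less_card_finite[where 'a = 'd] by linarith
  have "f (ln (CARD('d))) \<le> (\<Sum>j\<in>(UNIV::'d set). 1 / CARD('d))"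
    unfolding f_def
  proof (rule sum_mono)
    fix j
    have "ln (real (CARD('d))) * 1 \<le> ln (real (CARD('d))) * real_of_int (L j)"
      using assms[of j] n by (intro mult_left_mono) auto
    then have "exp (- ln (real (CARD('d))) * real_of_int (L j)) \<le> exp (- ln (real (CARD('d))))" by simp
    also have "\<dots> = 1 / CARD('d)" using n by (simp add: exp_minus inverse_eq_divide)
    finally show "exp (- ln (real (CARD('d))) * real_of_int (L j)) \<le> 1 / CARD('d)" .
  qed
  then have "f (ln (CARD('d))) \<le> 1" by simp
  moreover have "1 \<le> f 0" using n by (simp add: f_def)
  moreover have "0 \<le> ln (real (CARD('d)))" using n by simp
  moreover have "continuous_on {0..ln (real (CARD('d)))} f"
    unfolding f_def by (intro continuous_intros)
  ultimately obtain \<beta> where "f \<beta> = 1" using IVT2'[of f "ln (real (CARD('d)))" 1 0] by blast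
  then show ?thesis by (auto simp: f_def)
qed

section \<open>Existence of a KMS state\<close>

context cuntz_dynamics
begin

lemma \<sigma>_eval_word:
  "\<sigma> t (eval_word s w) = cis (t * sum_list (map (letter_weight L) (letters w))) *\<^sub>C eval_word s w"
proof -
  have l: "\<sigma> t (eval_letter s l) = cis (t * letter_weight L l) *\<^sub>C eval_letter s l" for l
    by (cases l) (simp_all add: \<sigma>_simps \<sigma>_gen adj_scaleC cis_cnj)
  have "\<sigma> t (prod_list (map (eval_letter s) ls))
      = cis (t * sum_list (map (letter_weight L) ls)) *\<^sub>C prod_list (map (eval_letter s) ls)" for ls
    by (induction ls)
      (simp_all add: \<sigma>_simps l mult_scaleC_left mult_scaleC_right scaleC_scaleC cis_mult distrib_left add.commute)
  then show ?thesis by (simp add: eval_word_def)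
qed

lemma star_subalgebra_eval_free: "star_subalgebra (range (eval_free s))"
proof -
  have "complex_vector.subspace (range (eval_free s))"
  proof (rule complex_vector.subspaceI)
    show "0 \<in> range (eval_free s)" by (rule image_eqI[of _ _ 0]) simp_all
    show "x + y \<in> range (eval_free s)" if "x \<in> range (eval_free s)" "y \<in> range (eval_free s)" for x y
      using that by (auto simp flip: eval_free_add)
    show "c *\<^sub>C x \<in> range (eval_free s)" if "x \<in> range (eval_free s)" for c x
      using that by (auto simp flip: eval_free_scale)
  qed
  then show ?thesis
    by (auto simp: star_subalgebra_def simp flip: eval_free_mult eval_free_adj)
qed

lemma \<sigma>_eval_free: "\<sigma> t (eval_free s f) \<in> range (eval_free s)"
proof (induction f rule: free_star_algebra_induct)
  case zero
  have "\<sigma> t (eval_free s 0) = eval_free s 0" using \<sigma>_diff[of t 1 1] by simp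
  then show ?case by (rule range_eqI)
next
  case (add f w c)
  then obtain g where g: "\<sigma> t (eval_free s f) = eval_free s g" by auto
  let ?h = "Poly_Mapping.single w (c * cis (t * sum_list (map (letter_weight L) (letters w)))) + g"
  have "\<sigma> t (eval_free s (Poly_Mapping.single w c + f)) = eval_free s ?h"
    by (simp add: eval_free_add \<sigma>_simps \<sigma>_eval_word g scaleC_scaleC)
  then show ?case by (rule range_eqI)
qed

text \<open>The analytic elements are the *-polynomials in the generators. A word of weight
  \<open>k\<close> continues to complex time \<open>z\<close> with the factor exp (\<i> k z). At
  \<i>\<beta> this is \<open>e k\<close>, exactly the price of moving the word from the left to the
  right inside the state.\<close>

lemma KMS_state_ex:
  assumes \<beta>: "(\<Sum>j\<in>UNIV. exp (- \<beta> * real_of_int (L j))) = 1"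
  shows "\<exists>\<omega>. KMS_state \<sigma> \<beta> \<omega>"
proof -
  define p where "p j = exp (- \<beta> * real_of_int (L j))" for j
  interpret W: cuntz_weights s p
    by unfold_locales (use \<beta> in \<open>simp_all add: p_def\<close>)
  define e where "e k = complex_of_real (exp (- \<beta> * real_of_int k))" for k
  have e_add: "e (k + l) = e k * e l" for k l
    by (simp add: e_def ring_distribs exp_add exp_diff exp_minus field_simps)
  have e0: "e 0 = 1" by (simp add: e_def)
  have letter: "W.\<omega> (eval_letter s l * x) = e (letter_weight L l) * W.\<omega> (x * eval_letter s l)" for l x
  proof (cases l)
    case (Gen j)
    then show ?thesis by (simp add: W.\<omega>_gen_mult e_def p_def)
  next
    case (Adj j)
    \<comment> \<open>For adjoint letters the relation for \<open>p j\<close> is read backwards,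
      \<open>e (- L j)\<close> being the reciprocal of \<open>p j\<close>.\<close>
    have "e (- L j) * W.\<omega> (x * (s j)\<^sup>\<star>) = e (- L j + L j) * W.\<omega> ((s j)\<^sup>\<star> * x)"
      by (simp only: e_add W.\<omega>_mult_adj_gen mult.assoc) (simp add: e_def p_def)
    then show ?thesis by (simp add: Adj e0)
  qed
  have "W.\<omega> (prod_list (map (eval_letter s) ls) * x)
      = e (sum_list (map (letter_weight L) ls)) * W.\<omega> (x * prod_list (map (eval_letter s) ls))" for ls x
  proof (induction ls arbitrary: x)
    case (Cons l ls)
    have "W.\<omega> (prod_list (map (eval_letter s) (l # ls)) * x)
        = e (letter_weight L l) * W.\<omega> (prod_list (map (eval_letter s) ls) * (x * eval_letter s l))"
      using letter[of l "prod_list (map (eval_letter s) ls) * x"] by (simp add: mult.assoc)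
    then show ?case by (simp add: Cons.IH mult.assoc e_add)
  qed (simp add: e0)
  then have word: "W.\<omega> (eval_word s w * x)
      = e (sum_list (map (letter_weight L) (letters w))) * W.\<omega> (x * eval_word s w)" for w x
    by (simp add: eval_word_def)
  have "\<exists>g. analytic_extension \<sigma> (eval_free s f) g \<and>
      (\<forall>x. W.\<omega> (x * g (\<i> * complex_of_real \<beta>)) = W.\<omega> (eval_free s f * x))" for f
  proof (induction f rule: free_star_algebra_induct)
    case zero
    have "analytic_extension \<sigma> 0 (\<lambda>z. 0)"
      using \<sigma>_diff[of _ 1 1] unfolding analytic_extension_def
      by (auto intro!: exI[of _ 0])
    then show ?case by (intro exI[of _ "\<lambda>z. 0"]) simp
  next
    case (add f w c)
    then obtain g where g: "analytic_extension \<sigma> (eval_free s f) g"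
      and KMS: "\<And>x. W.\<omega> (x * g (\<i> * complex_of_real \<beta>)) = W.\<omega> (eval_free s f * x)" by blast
    define k where "k = sum_list (map (letter_weight L) (letters w))"
    define a where "a = eval_word s w"
    define h where "h z = (c * exp (\<i> * of_int k * z)) *\<^sub>C a" for z
    have bl: "bounded_linear (\<lambda>z. z *\<^sub>C a)"
      by (rule bounded_linear_intro[where K = "norm a"])
        (simp_all add: scaleC_add_left scaleR_scaleC scaleC_scaleC scaleR_conv_of_real)
    have der: "\<exists>D. ((\<lambda>z. h z + g z) has_derivative (\<lambda>u. u *\<^sub>C D)) (at z)" for z
    proof -
      obtain D where D: "(g has_derivative (\<lambda>u. u *\<^sub>C D)) (at z)"
        using g unfolding analytic_extension_def by blast
      have "((\<lambda>z. c * exp (\<i> * of_int k * z)) has_field_derivative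
          c * (exp (\<i> * of_int k * z) * (\<i> * of_int k))) (at z)"
        by (auto intro!: derivative_eq_intros)
      then have "((\<lambda>z. c * exp (\<i> * of_int k * z)) has_derivative
          (*) (c * (exp (\<i> * of_int k * z) * (\<i> * of_int k)))) (at z)"
        by (simp only: has_field_derivative_def)
      from has_derivative_add[OF bounded_linear.has_derivative[OF bl this] D]
      have "((\<lambda>z. h z + g z) has_derivative
          (\<lambda>u. u *\<^sub>C ((c * (exp (\<i> * of_int k * z) * (\<i> * of_int k))) *\<^sub>C a + D))) (at z)"
        by (simp add: h_def scaleC_add_right scaleC_scaleC mult.commute)
      then show ?thesis by blast
    qed
    have "exp (\<i> * of_int k * complex_of_real t) = cis (t * of_int k)" for t
      by (simp add: cis_conv_exp mult_ac)
    then have "h (complex_of_real t) + g (complex_of_real t) = \<sigma> t (eval_free s (Poly_Mapping.single w c + f))" for t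
      using g by (simp add: analytic_extension_def eval_free_add \<sigma>_simps \<sigma>_eval_word h_def a_def
          scaleC_scaleC k_def)
    with der have ext: "analytic_extension \<sigma> (eval_free s (Poly_Mapping.single w c + f)) (\<lambda>z. h z + g z)"
      by (simp add: analytic_extension_def)
    have "\<i> * of_int k * (\<i> * complex_of_real \<beta>) = complex_of_real (- \<beta> * of_int k)"
      by (simp add: algebra_simps)
    then have "h (\<i> * complex_of_real \<beta>) = (c * e k) *\<^sub>C a"
      by (simp only: h_def e_def exp_of_real)
    then have "W.\<omega> (x * (h (\<i> * complex_of_real \<beta>) + g (\<i> * complex_of_real \<beta>)))
        = W.\<omega> (eval_free s (Poly_Mapping.single w c + f) * x)" for x
      by (simp add: distrib_left distrib_right W.\<omega>_add KMS eval_free_add mult_scaleC_left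
          mult_scaleC_right W.\<omega>_scaleC word a_def k_def)
    with ext show ?case by blast
  qed
  then have "\<forall>y\<in>range (eval_free s). \<exists>g. analytic_extension \<sigma> y g \<and>
      (\<forall>x\<in>range (eval_free s). W.\<omega> (x * g (\<i> * complex_of_real \<beta>)) = W.\<omega> (y * x))"
    by blast
  then have "KMS_state \<sigma> \<beta> W.\<omega>"
    unfolding KMS_state_def
    using W.state_\<omega> star_subalgebra_eval_free dense \<sigma>_eval_free
    by (intro conjI exI[of _ "range (eval_free s)"]) auto
  then show ?thesis by blast
qed

end

section \<open>The values that a KMS state must take\<close>

context cuntz_dynamics
begin

text \<open>If \<open>D\<close> contained \<open>s j\<close> and its adjoint, the KMS identity would
  give the value at once. In general, approximants \<open>x\<close> and \<open>y\<close> in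
  \<open>D\<close> define \<open>F\<close>, and \<open>H\<close> removes from it the phase of weight
  \<open>k\<close>. \<open>H\<close> is periodic, close to 1 on the real line and close to
  \<open>a\<close> on the line of imaginary part \<beta>. Since the two means coincide,
  \<open>a\<close> is within a constant times \<open>r\<close> of 1 for every small
  \<open>r\<close>.\<close>

lemma KMS_range_projection:
  assumes "KMS_state \<sigma> \<beta> \<omega>"
  shows "\<omega> (s j * (s j)\<^sup>\<star>) = of_real (exp (- \<beta> * real_of_int (L j)))"
proof -
  obtain D where state: "state \<omega>" and D: "closure D = UNIV" and inv: "\<And>t y. y \<in> D \<Longrightarrow> \<sigma> t y \<in> D"
    and KMS: "\<And>y. y \<in> D \<Longrightarrow> \<exists>f. analytic_extension \<sigma> y f \<and>
           (\<forall>x\<in>D. \<omega> (x * f (\<i> * complex_of_real \<beta>)) = \<omega> (y * x))"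
    using assms unfolding KMS_state_def by (elim conjE exE) blast
  have \<omega>_simps: "\<omega> (x + y) = \<omega> x + \<omega> y" "\<omega> (c *\<^sub>C x) = c * \<omega> x" "\<omega> 1 = 1" for x y c
    using state by (auto simp: state_def)
  have bl: "bounded_linear \<omega>"
    by (rule bounded_linear_intro[where K = 2])
      (use state_norm_le[OF state] in \<open>simp_all add: \<omega>_simps scaleR_scaleC mult.commute
        scaleR_conv_of_real[where 'a = complex]\<close>)
  have \<omega>_diff: "\<omega> (x - y) = \<omega> x - \<omega> y" for x y by (rule linear_diff[OF bounded_linear.linear[OF bl]])
  define k where "k = L j"
  define a where "a = of_real (exp (\<beta> * of_int k)) * \<omega> (s j * (s j)\<^sup>\<star>)"
  have near: "cmod (a - 1) \<le> r * (6 + exp (\<beta> * of_int k) * 6)" if r: "0 < r" "r \<le> 1" for r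
  proof -
    have "\<exists>x\<in>D. dist x u < r" for u
      using D r by (intro closure_approachable[THEN iffD1, rule_format]) auto
    then obtain x y where x: "x \<in> D" "norm (x - (s j)\<^sup>\<star>) < r" and y: "y \<in> D" "norm (y - s j) < r"
      unfolding dist_norm by metis
    obtain f where f: "analytic_extension \<sigma> y f" using KMS[OF y(1)] by blast
    define F where "F z = \<omega> (x * f z)" for z
    have hol: "(\<lambda>z. \<omega> (x * g z)) holomorphic_on UNIV" if g: "analytic_extension \<sigma> u g" for g u
    proof -
      have "(\<lambda>z. \<omega> (x * g z)) field_differentiable at z" for z
      proof -
        obtain d where d: "(g has_derivative (\<lambda>h. h *\<^sub>C d)) (at z)"
          using g unfolding analytic_extension_def by blast
        have "((\<lambda>z. \<omega> (x * g z)) has_derivative (\<lambda>h. \<omega> (x * (h *\<^sub>C d)))) (at z)"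
          by (intro bounded_linear.has_derivative[OF bl] has_derivative_mult_right d)
        then have "((\<lambda>z. \<omega> (x * g z)) has_field_derivative \<omega> (x * d)) (at z)"
          unfolding has_field_derivative_def
          by (rule has_derivative_eq_rhs) (auto simp: mult_scaleC_right \<omega>_simps mult.commute)
        then show ?thesis by (auto simp: field_differentiable_def)
      qed
      then show ?thesis by (simp add: holomorphic_on_def field_differentiable_at_within)
    qed
    have F: "F holomorphic_on UNIV" using hol[OF f] by (simp add: F_def[abs_def])
    have F_real: "F (of_real t) = \<omega> (x * \<sigma> t y)" for t
      using f by (simp add: F_def analytic_extension_def)
    have F_shift: "(\<lambda>z. F (z + c)) holomorphic_on UNIV" for c
    proof -
      have "(\<lambda>z. z + c) holomorphic_on UNIV" by (intro holomorphic_intros)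
      from holomorphic_on_compose_gen[OF this F] show ?thesis by (simp add: o_def)
    qed
    have F_per: "F (z + 2 * of_real pi) = F z" for z
    proof (rule entire_eq_on_reals[OF F_shift F])
      fix t
      have "complex_of_real t + 2 * of_real pi = of_real (t + 2 * pi)" by simp
      then show "F (complex_of_real t + 2 * of_real pi) = F (complex_of_real t)"
        by (simp only: F_real \<sigma>_period)
    qed
    \<comment> \<open>The KMS condition is applied to \<open>\<sigma> t y\<close>, for which it
      supplies an extension \<open>g\<close> of its own. By the group law \<open>g\<close> and the
      shifted extension of \<open>y\<close> agree at real times, and after pairing with
      \<open>x\<close> the identity theorem makes them agree everywhere.\<close>
    have F_KMS: "F (\<i> * of_real \<beta> + of_real t) = \<omega> (\<sigma> t y * x)" for t
    proof -
      obtain g where g: "analytic_extension \<sigma> (\<sigma> t y) g"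
        and "\<omega> (x * g (\<i> * complex_of_real \<beta>)) = \<omega> (\<sigma> t y * x)"
        using KMS[OF inv[OF y(1)]] x(1) by blast
      moreover have "\<omega> (x * g z) = F (z + of_real t)" for z
      proof (rule entire_eq_on_reals[OF hol[OF g] F_shift])
        fix u
        have "complex_of_real u + complex_of_real t = of_real (u + t)" by simp
        then show "\<omega> (x * g (complex_of_real u)) = F (complex_of_real u + complex_of_real t)"
          using g by (simp only: F_real) (simp add: analytic_extension_def \<sigma>_plus)
      qed
      ultimately show ?thesis by simp
    qed
    define H where "H z = exp (- \<i> * of_int k * z) * F z" for z
    have H: "H holomorphic_on UNIV" unfolding H_def[abs_def] by (intro holomorphic_intros F)
    have "exp (- \<i> * of_int k * (z + 2 * of_real pi)) = exp (- \<i> * of_int k * z)" for z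
      using exp_plus_2pin[of "- \<i> * of_int k * z" "- k"] by (simp add: algebra_simps)
    then have H_per: "H (z + 2 * of_real pi) = H z" for z by (simp only: H_def F_per)
    have \<sigma>s: "exp (- \<i> * of_int k * complex_of_real t) *\<^sub>C \<sigma> t (s j) = s j" for t
    proof -
      have "exp (- \<i> * of_int k * complex_of_real t) * cis (t * of_int (L j)) = 1"
        by (simp add: cis_conv_exp k_def mult_ac flip: exp_add)
      then show ?thesis by (simp add: \<sigma>_gen scaleC_scaleC)
    qed
    have unit: "cmod (exp (- \<i> * of_int k * complex_of_real t)) = 1" for t
      by (simp add: norm_exp_eq_Re)
    \<comment> \<open>Compensating the phase of \<open>s j\<close> keeps the moving approximant
      within \<open>r\<close> of the fixed element \<open>s j\<close>, uniformly in
      \<open>t\<close>.\<close>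
    define y' where "y' t = exp (- \<i> * of_int k * complex_of_real t) *\<^sub>C \<sigma> t y" for t
    have y': "norm (y' t - s j) < r" for t
    proof -
      have "y' t - s j = exp (- \<i> * of_int k * complex_of_real t) *\<^sub>C \<sigma> t (y - s j)"
        unfolding \<sigma>_diff complex_vector.scale_right_diff_distrib \<sigma>s y'_def ..
      then have "norm (y' t - s j) = norm (\<sigma> t (y - s j))" using unit by simp
      also have "\<dots> < r" using norm_\<sigma> y(2) by (rule le_less_trans)
      finally show ?thesis .
    qed
    \<comment> \<open>The 6 is 2 * (2 + 1): the state contributes 2, \<open>norm v\<close> is at
      most 2 because \<open>r \<le> 1\<close>, and \<open>u'\<close> has norm 1.\<close>
    have close: "cmod (\<omega> (u * v) - \<omega> (u' * v')) \<le> 6 * r"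
      if u: "norm (u - u') < r" "norm u' = 1" and v: "norm (v - v') < r" "norm v' = 1" for u u' v v'
    proof -
      have "cmod (\<omega> (u * v) - \<omega> (u' * v')) \<le> 2 * norm (u * v - u' * v')"
        using state_norm_le[OF state, of "u * v - u' * v'"] by (simp add: \<omega>_diff)
      also have "u * v - u' * v' = (u - u') * v + u' * (v - v')" by (simp add: algebra_simps)
      also have "norm ((u - u') * v + u' * (v - v')) \<le> norm ((u - u') * v) + norm (u' * (v - v'))"
        by (rule norm_triangle_ineq)
      also have "norm ((u - u') * v) \<le> r * 2"
        using u v r norm_triangle_ineq[of "v - v'" v']
        by (intro order_trans[OF norm_mult_ineq] mult_mono) auto
      also have "norm (u' * (v - v')) \<le> 1 * r"
        using u v by (intro order_trans[OF norm_mult_ineq] mult_mono) auto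
      finally show ?thesis by simp
    qed
    have "cmod (H (0 + complex_of_real t) - 1) \<le> 6 * r" for t
    proof -
      have "H (0 + complex_of_real t) = \<omega> (x * y' t)"
        by (simp add: H_def F_real y'_def mult_scaleC_right \<omega>_simps)
      moreover have "\<omega> ((s j)\<^sup>\<star> * s j) = 1" by (simp add: orthogonal \<omega>_simps)
      ultimately show ?thesis
        using close[OF x(2) _ y'[of t]] by (simp add: norm_gen)
    qed
    moreover have "cmod (H (\<i> * of_real \<beta> + complex_of_real t) - a) \<le> exp (\<beta> * of_int k) * (6 * r)" for t
    proof -
      have "- \<i> * of_int k * (\<i> * of_real \<beta> + complex_of_real t)
          = of_real (\<beta> * of_int k) + - \<i> * of_int k * complex_of_real t"
        by (simp add: algebra_simps)
      then have "H (\<i> * of_real \<beta> + complex_of_real t) = of_real (exp (\<beta> * of_int k)) * \<omega> (y' t * x)"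
        unfolding H_def F_KMS y'_def
        by (simp only: exp_add exp_of_real mult_scaleC_left \<omega>_simps mult.assoc)
      then have "H (\<i> * of_real \<beta> + complex_of_real t) - a
          = of_real (exp (\<beta> * of_int k)) * (\<omega> (y' t * x) - \<omega> (s j * (s j)\<^sup>\<star>))"
        by (simp only: a_def right_diff_distrib)
      moreover have "cmod (\<omega> (y' t * x) - \<omega> (s j * (s j)\<^sup>\<star>)) \<le> 6 * r"
        using close[OF y'[of t] _ x(2)] by (simp add: norm_gen)
      ultimately show ?thesis by (simp add: norm_mult)
    qed
    ultimately have "cmod (1 - a) \<le> 6 * r + exp (\<beta> * of_int k) * (6 * r)"
      using periodic_entire_means[OF H H_per] by blast
    then show ?thesis by (simp add: norm_minus_commute algebra_simps)
  qed
  define K where "K = 6 + exp (\<beta> * of_int k) * 6"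
  have K: "K > 0" by (simp add: K_def add_pos_pos)
  have "a = 1"
  proof (rule ccontr)
    assume "a \<noteq> 1"
    then have pos: "cmod (a - 1) > 0" by simp
    define r where "r = min 1 (cmod (a - 1) / (2 * K))"
    have r: "0 < r" "r \<le> 1" using pos K by (simp_all add: r_def)
    have "r * K \<le> cmod (a - 1) / (2 * K) * K"
      using K by (intro mult_right_mono) (auto simp: r_def)
    also have "\<dots> = cmod (a - 1) / 2" using K by simp
    finally show False using near[OF r] pos by (simp add: K_def)
  qed
  have "of_real (exp (- \<beta> * of_int k)) * a = \<omega> (s j * (s j)\<^sup>\<star>)"
    by (simp add: a_def exp_minus field_simps)
  then show ?thesis using \<open>a = 1\<close> by (simp add: k_def)
qed

lemma KMS_same_sign:
  assumes "KMS_state \<sigma> \<beta> \<omega>"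
  shows "(\<forall>j. L j > 0) \<or> (\<forall>j. L j < 0)"
proof -
  have add: "\<omega> (x + y) = \<omega> x + \<omega> y" and one: "\<omega> 1 = 1" for x y
    using assms by (auto simp: KMS_state_def state_def)
  have zero: "\<omega> 0 = 0" using add[of 0 0] by (simp only: add_0_left) simp
  have sum: "\<omega> (sum g A) = (\<Sum>j\<in>A. \<omega> (g j))" if "finite A" for g and A :: "'d set"
    using that by (induction A) (simp_all add: add zero)
  define p where "p j = exp (- \<beta> * real_of_int (L j))" for j
  have "complex_of_real (\<Sum>j\<in>UNIV. p j) = \<omega> (\<Sum>j\<in>UNIV. s j * (s j)\<^sup>\<star>)"
    by (simp only: sum finite KMS_range_projection[OF assms] p_def of_real_sum)
  also have "\<dots> = 1" by (simp only: sum_range_projections one)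
  finally have "(\<Sum>j\<in>UNIV. p j) = 1" by (simp only: of_real_eq_1_iff)
  then interpret W: cuntz_weights s p
    by unfold_locales (simp_all add: p_def)
  have "\<beta> * real_of_int (L j) > 0" for j
    using W.p_less_1[of j] by (simp add: p_def)
  then show ?thesis
    by (cases "\<beta> > 0") (simp_all add: zero_less_mult_iff not_less)
qed

end

theorem proposition4p1:
  fixes s :: "'d::finite \<Rightarrow> 'a::unital_cstar_algebra"
    and L :: "'d \<Rightarrow> int"
    and \<sigma> :: "real \<Rightarrow> 'a \<Rightarrow> 'a"
  assumes "2 \<le> CARD('d)"
    and "cuntz_algebra s"
    and "cuntz_flow s L \<sigma>"
  shows "(AF_algebra (fixed_point_algebra \<sigma>) \<longleftrightarrow> ((\<forall>j. L j > 0) \<or> (\<forall>j. L j < 0))) \<and>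
    (((\<forall>j. L j > 0) \<or> (\<forall>j. L j < 0)) \<longleftrightarrow> (\<exists>\<beta> \<omega>. KMS_state \<sigma> \<beta> \<omega>)) \<and>
    (\<not> ((\<forall>j. L j > 0) \<or> (\<forall>j. L j < 0)) \<longrightarrow>
      (\<exists>v\<in>fixed_point_algebra \<sigma>. v\<^sup>\<star> * v = 1 \<and> v * v\<^sup>\<star> \<noteq> 1))"
proof -
  interpret C: cuntz_dynamics s L \<sigma>
    using assms by unfold_locales
  let ?S = "(\<forall>j. L j > 0) \<or> (\<forall>j. L j < 0)"
  have AF: "AF_algebra (fixed_point_algebra \<sigma>)" if ?S
    using that
  proof
    assume "\<forall>j. L j > 0"
    then show ?thesis by (intro C.AF_fixed_point_algebra) simp
  next
    assume neg: "\<forall>j. L j < 0"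
    \<comment> \<open>Reversing time negates all weights and keeps the fixed points, so the negative
      case reduces to the positive one. For KMS states the same symmetry appears as a change of sign
      of \<beta>.\<close>
    define \<tau> where "\<tau> t = \<sigma> (- t)" for t
    have "one_parameter_group \<tau>"
      using assms(3) unfolding cuntz_flow_def one_parameter_group_def \<tau>_def
      by (metis add.inverse_neutral minus_add_distrib)
    then have "cuntz_flow s (\<lambda>j. - L j) \<tau>"
      by (simp add: cuntz_flow_def \<tau>_def C.\<sigma>_gen)
    then interpret N: cuntz_dynamics s "\<lambda>j. - L j" \<tau>
      using assms by unfold_locales
    have "fixed_point_algebra \<tau> = fixed_point_algebra \<sigma>"
      unfolding fixed_point_algebra_def \<tau>_def by (metis minus_minus)
    then show ?thesis using N.AF_fixed_point_algebra neg by simp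
  qed
  have KMS: "\<exists>\<beta> \<omega>. KMS_state \<sigma> \<beta> \<omega>" if ?S
    using that
  proof
    assume "\<forall>j. L j > 0"
    then show ?thesis using exp_weights_ex[of L] C.KMS_state_ex by blast
  next
    assume "\<forall>j. L j < 0"
    then obtain \<beta> where "(\<Sum>j\<in>UNIV. exp (- \<beta> * real_of_int (- L j))) = 1"
      using exp_weights_ex[of "\<lambda>j. - L j"] by auto
    then have "(\<Sum>j\<in>UNIV. exp (- (- \<beta>) * real_of_int (L j))) = 1" by simp
    then show ?thesis using C.KMS_state_ex by blast
  qed
  have iso: "\<exists>v\<in>fixed_point_algebra \<sigma>. v\<^sup>\<star> * v = 1 \<and> v * v\<^sup>\<star> \<noteq> 1" if "\<not> ?S"
    using that by (rule C.fixed_nonunitary_isometry)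
  have "?S" if "AF_algebra (fixed_point_algebra \<sigma>)"
    using iso AF_isometry_unitary[OF that] by blast
  with AF KMS iso C.KMS_same_sign show ?thesis by blast
qed

end
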